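(* Let $\mathsf{R}$ (resp. $\mathsf{R}'$) be the set of 2-colored partitions satisfying conditions (D1)–(D3) (resp. (D1)–(D4)) listed in the context. Then, as formal power series in $x$ and $q$, $$\sum_{\lambda\in\mathsf{R}}x^{\ell(\lambda)}q^{|\lambda|}=\sum_{a,b,c,d\ge0}\frac{q^{a^2+b^2+3c^2+3d^2+2ab+3ac+3ad+3bc+3bd+6cd}\,x^{a+b+2c+2d}}{(q;q)_a(q;q)_b(q^3;q^3)_c(q^3;q^3)_d},$$ $$\sum_{\lambda\in\mathsf{R}'}x^{\ell(\lambda)}q^{|\lambda|}=\sum_{a,b,c,d\ge0}\frac{q^{a(a+1)+b(b+2)+3c(c+1)+3d(d+1)+2ab+3ac+3ad+3bc+3bd+6cd}\,x^{a+b+2c+2d}}{(q;q)_a(q;q)_b(q^3;q^3)_c(q^3;q^3)_d}.$$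
   Context: $(a;q)_n=\prod_{0\le j<n}(1-aq^j)$ for $n\in\mathbb{Z}_{\ge0}$. For each positive integer $k$ there is an ordinary copy $k$ and a "colored" copy $\underline{k}_c$. Put $\mathsf{cont}(k)=\mathsf{cont}(\underline{k}_c)=k$, $\mathsf{color}(k)=+$, $\mathsf{color}(\underline{k}_c)=-$. Order them by $\cdots>3>\underline{3}_c>2>\underline{2}_c>1>\underline{1}_c$. A 2-colored partition is a finite (possibly empty) weakly decreasing sequence $\lambda=(\lambda_1,\dots,\lambda_\ell)$ of positive integers and colored positive integers (its parts) for this order; its length is $\ell(\lambda)=\ell$ (the number of parts) and its size is $|\lambda|=\mathsf{cont}(\lambda_1)+\dots+\mathsf{cont}(\lambda_\ell)$. We say $\lambda$ contains $\mu=(\mu_1,\dots,\mu_{\ell'})$ if there is $0\le i\le \ell-\ell'$ with $\lambda_{j+i}=\mu_j$ for $1\le j\le\ell'$. Conditions on $\lambda$: (D1) If consecutive parts $\lambda_a,\lambda_{a+1}$ ($1\le a<\ell$) satisfy $\mathsf{cont}(\lambda_a)-\mathsf{cont}(\lambda_{a+1})\le 1$, then $\mathsf{cont}(\lambda_a)+\mathsf{cont}(\lambda_{a+1})\in3\mathbb{Z}$ and $\mathsf{color}(\lambda_a)\neq\mathsf{color}(\lambda_{a+1})$. (D2) If consecutive parts $\lambda_a,\lambda_{a+1}$ ($1\le a<\ell$) satisfy $\mathsf{cont}(\lambda_a)-\mathsf{cont}(\lambda_{a+1})=2$ and $\mathsf{cont}(\lambda_a)+\mathsf{cont}(\lambda_{a+1})\notin3\mathbb{Z}$,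 then $(\mathsf{color}(\lambda_a),\mathsf{color}(\lambda_{a+1}))\neq(-,+)$. (D3) $\lambda$ does not contain $(3k,\underline{3k}_c,\underline{3k-2}_c)$, $(3k+2,3k,\underline{3k}_c)$, or $(\underline{3k+2}_c,3k+1,3k-1,\underline{3k-2}_c)$ for any $k\ge1$. (D4) $\lambda$ does not contain $1$, $\underline{1}_c$, or $\underline{2}_c$ as a part. *)

theory Defs
  imports
    "HOL-Analysis.Infinite_Sum"
    "HOL-Computational_Algebra.Formal_Power_Series"
    "HOL-Library.Sublist"
begin

section \<open>Two-colored partitions\<close>

datatype sign = Plus | Minus

text \<open>Positivity of the underlying integers is imposed in \<open>two_colored_partition\<close>, not by the type.\<close>

datatype part = Ordinary nat | Colored nat

fun cont :: "part \<Rightarrow> nat" where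
  "cont (Ordinary k) = k"
| "cont (Colored k) = k"

fun color :: "part \<Rightarrow> sign" where
  "color (Ordinary k) = Plus"
| "color (Colored k) = Minus"

text \<open>The order \<open>\<dots> > 3 > \<close>colored \<open>3 > 2 > \<close>colored \<open>2 > 1 > \<close>colored \<open>1\<close>.\<close>

instantiation part :: linorder
begin

definition less_part :: "part \<Rightarrow> part \<Rightarrow> bool" where
  "p < r \<longleftrightarrow> cont p < cont r \<or> (cont p = cont r \<and> color p = Minus \<and> color r = Plus)"

definition less_eq_part :: "part \<Rightarrow> part \<Rightarrow> bool" where
  "p \<le> r \<longleftrightarrow> p < r \<or> p = (r :: part)"

instance
proof
  fix p r s :: part
  show "p < r \<longleftrightarrow> p \<le> r \<and> \<not> r \<le> p"
    by (auto simp: less_part_def less_eq_part_def)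
  show "p \<le> p"
    by (simp add: less_eq_part_def)
  show "p \<le> s" if "p \<le> r" "r \<le> s"
    using that by (auto simp: less_part_def less_eq_part_def)
  show "p = r" if "p \<le> r" "r \<le> p"
    using that by (auto simp: less_part_def less_eq_part_def)
  show "p \<le> r \<or> r \<le> p"
    by (cases p; cases r) (auto simp: less_part_def less_eq_part_def)
qed

end

definition two_colored_partition :: "part list \<Rightarrow> bool" where
  "two_colored_partition l \<longleftrightarrow> sorted_wrt (\<ge>) l \<and> (\<forall>p\<in>set l. cont p \<ge> 1)"

definition psize :: "part list \<Rightarrow> nat" where
  "psize l = sum_list (map cont l)"

definition D1 :: "part list \<Rightarrow> bool" where
  "D1 l \<longleftrightarrow> (\<forall>a. Suc a < length l \<longrightarrow>
     int (cont (l ! a)) - int (cont (l ! Suc a)) \<le> 1 \<longrightarrow>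
     3 dvd cont (l ! a) + cont (l ! Suc a) \<and> color (l ! a) \<noteq> color (l ! Suc a))"

definition D2 :: "part list \<Rightarrow> bool" where
  "D2 l \<longleftrightarrow> (\<forall>a. Suc a < length l \<longrightarrow>
     int (cont (l ! a)) - int (cont (l ! Suc a)) = 2 \<and>
     \<not> 3 dvd cont (l ! a) + cont (l ! Suc a) \<longrightarrow>
     (color (l ! a), color (l ! Suc a)) \<noteq> (Minus, Plus))"

text \<open>Containment of partitions is containment as a contiguous factor, i.e.\ \<open>sublist\<close>.
  The truncated subtractions are harmless since \<open>k \<ge> 1\<close>.\<close>

definition D3 :: "part list \<Rightarrow> bool" where
  "D3 l \<longleftrightarrow> (\<forall>k\<ge>1.
     \<not> sublist [Ordinary (3*k), Colored (3*k), Colored (3*k - 2)] l \<and>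
     \<not> sublist [Ordinary (3*k + 2), Ordinary (3*k), Colored (3*k)] l \<and>
     \<not> sublist [Colored (3*k + 2), Ordinary (3*k + 1), Ordinary (3*k - 1), Colored (3*k - 2)] l)"

definition D4 :: "part list \<Rightarrow> bool" where
  "D4 l \<longleftrightarrow> Ordinary 1 \<notin> set l \<and> Colored 1 \<notin> set l \<and> Colored 2 \<notin> set l"

definition R :: "part list set" where
  "R = {l. two_colored_partition l \<and> D1 l \<and> D2 l \<and> D3 l}"

definition R' :: "part list set" where
  "R' = {l. two_colored_partition l \<and> D1 l \<and> D2 l \<and> D3 l \<and> D4 l}"


section \<open>Formal power series in \<open>x\<close> and \<open>q\<close>\<close>

text \<open>Series in \<open>x\<close> and \<open>q\<close> are power series in \<open>q\<close> whose coefficients are power series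
  in \<open>x\<close>. Infinite sums refer to the library's topology on \<open>fps\<close>, here the \<open>q\<close>-adic one:
  a sum converges iff each coefficient of \<open>q ^ m\<close> is eventually constant. It matters that
  \<open>q\<close> is the outer variable, since infinitely many partitions share a given length.\<close>

abbreviation q_var :: "rat fps fps" where
  "q_var \<equiv> fps_X"

abbreviation x_var :: "rat fps fps" where
  "x_var \<equiv> fps_const fps_X"

definition qpoch :: "'a::comm_ring_1 \<Rightarrow> 'a \<Rightarrow> nat \<Rightarrow> 'a" where
  "qpoch a q n = (\<Prod>j<n. 1 - a * q ^ j)"

end

theory Submission
  imports Defs
begin

text \<open>
  Let \<open>X\<^sub>c\<close> be the generating function of the partitions in \<open>R\<close> all of whose parts have
  content at least \<open>c\<close>. Removing the smallest part, and remembering which parts may follow it,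
  gives a closed linear system that expresses \<open>X\<^sub>c\<close> through \<open>X\<^sub>d\<close> with \<open>d > c\<close>; its coefficients
  depend on \<open>c\<close> modulo 3 only, up to replacing \<open>x\<close> by \<open>x q\<^sup>3\<close>. Let \<open>S(\<alpha>, \<beta>, \<gamma>, \<delta>)\<close> be the
  quadruple sum with the linear form \<open>\<alpha> a + \<beta> b + 3 \<gamma> c + 3 \<delta> d\<close> added to the exponent of \<open>q\<close>.
  Then \<open>S(0,0,0,0)\<close> in place of \<open>X\<^sub>1\<close> and \<open>S(1,2,1,1) \<plusminus> x q\<^sup>2 S(3,3,2,2)\<close> in place of
  \<open>X\<^sub>2\<close> (sign \<open>+\<close>) and \<open>X\<^sub>3\<close> (sign \<open>-\<close>) solve the same system, by the contiguous relations that come from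
  \<open>1 / (q;q)\<^sub>a - q\<^sup>a / (q;q)\<^sub>a = 1 / (q;q)\<^sub>a\<^sub>-\<^sub>1\<close>. A solution of the system with
  \<open>X\<^sub>c \<equiv> 1\<close> modulo \<open>q\<^sup>c\<close> is unique, since the differences of two solutions are divisible by every
  power of \<open>q\<close>. Finally \<open>R'\<close> has the generating function \<open>X\<^sub>3 + x q\<^sup>2 X\<^sub>4 = S(1,2,1,1)\<close>.
\<close>

section \<open>Summation of formal power series\<close>

text \<open>Coefficient n of a sum depends only on coefficient n of the summands. This instance and
  the next make the general rules for adding, splitting and scaling infinite sums available for
  series.\<close>

instance fps :: (ab_group_add) topological_ab_group_add
proof
  fix a b :: "'a fps"
  have *: "filterlim fst (nhds a) (nhds a \<times>\<^sub>F nhds b)" "filterlim snd (nhds b) (nhds a \<times>\<^sub>F nhds b)"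
    by (rule filterlim_fst, rule filterlim_snd)
  show "LIM x (nhds a \<times>\<^sub>F nhds b). fst x + snd x :> nhds (a + b)"
  proof (rule tendsto_fpsI)
    fix n
    have "eventually (\<lambda>x. fps_nth (fst x) n = fps_nth a n) (nhds a \<times>\<^sub>F nhds b)"
         "eventually (\<lambda>x. fps_nth (snd x) n = fps_nth b n) (nhds a \<times>\<^sub>F nhds b)"
      using * unfolding tendsto_fps_iff by blast+
    thus "eventually (\<lambda>x. fps_nth (fst x + snd x) n = fps_nth (a + b) n) (nhds a \<times>\<^sub>F nhds b)"
      by eventually_elim simp
  qed
  have "filterlim (\<lambda>x. x) (nhds a) (nhds a)"
    by (rule filterlim_ident)
  thus "(uminus \<longlongrightarrow> - a) (nhds a)"
    unfolding tendsto_fps_iff by (auto elim!: allE elim: eventually_mono)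
qed

instance fps :: (ring) topological_semigroup_mult
proof
  fix a b :: "'a fps"
  have *: "filterlim fst (nhds a) (nhds a \<times>\<^sub>F nhds b)" "filterlim snd (nhds b) (nhds a \<times>\<^sub>F nhds b)"
    by (rule filterlim_fst, rule filterlim_snd)
  show "LIM x (nhds a \<times>\<^sub>F nhds b). fst x * snd x :> nhds (a * b)"
  proof (rule tendsto_fpsI)
    fix n
    have "eventually (\<lambda>x. \<forall>i\<in>{..n}. fps_nth (fst x) i = fps_nth a i \<and> fps_nth (snd x) i = fps_nth b i)
            (nhds a \<times>\<^sub>F nhds b)"
      using * unfolding tendsto_fps_iff
      by (subst eventually_ball_finite_distrib) (auto intro: eventually_conj)
    thus "eventually (\<lambda>x. fps_nth (fst x * snd x) n = fps_nth (a * b) n) (nhds a \<times>\<^sub>F nhds b)"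
      by eventually_elim (auto simp: fps_mult_nth intro!: sum.cong)
  qed
qed

text \<open>Once a finite partial sum contains every term that contributes to coefficient n, that
  coefficient no longer changes.\<close>

lemma summable_on_fps:
  fixes f :: "'b \<Rightarrow> 'a::ab_group_add fps"
  assumes "\<And>n. finite {i \<in> A. fps_nth (f i) n \<noteq> 0}"
  shows "f summable_on A"
proof -
  define s where "s = Abs_fps (\<lambda>n. \<Sum>i | i \<in> A \<and> fps_nth (f i) n \<noteq> 0. fps_nth (f i) n)"
  have "(sum f \<longlongrightarrow> s) (finite_subsets_at_top A)"
  proof (rule tendsto_fpsI)
    fix n
    let ?B = "{i \<in> A. fps_nth (f i) n \<noteq> 0}"
    show "eventually (\<lambda>F. fps_nth (sum f F) n = fps_nth s n) (finite_subsets_at_top A)"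
      unfolding eventually_finite_subsets_at_top
    proof (intro exI[of _ ?B] conjI allI impI)
      fix F assume F: "finite F \<and> ?B \<subseteq> F \<and> F \<subseteq> A"
      show "fps_nth (sum f F) n = fps_nth s n"
        unfolding fps_sum_nth s_def fps_nth_Abs_fps
        by (rule sum.mono_neutral_right) (use F in auto)
    qed (use assms in auto)
  qed
  thus ?thesis
    by (auto simp: summable_on_def has_sum_def)
qed

lemma has_sum_fps_nth:
  fixes f :: "'b \<Rightarrow> 'a::ab_group_add fps"
  assumes "(f has_sum s) A" "finite B" "B \<subseteq> A" "\<And>i. i \<in> A - B \<Longrightarrow> fps_nth (f i) n = 0"
  shows "fps_nth s n = (\<Sum>i\<in>B. fps_nth (f i) n)"
proof -
  have "eventually (\<lambda>F. fps_nth (sum f F) n = fps_nth s n) (finite_subsets_at_top A)"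
    using assms(1) by (simp add: has_sum_def tendsto_fps_iff)
  then obtain F where F: "finite F" "F \<subseteq> A"
      "\<And>G. finite G \<Longrightarrow> F \<subseteq> G \<Longrightarrow> G \<subseteq> A \<Longrightarrow> fps_nth (sum f G) n = fps_nth s n"
    by (auto simp: eventually_finite_subsets_at_top)
  have "fps_nth s n = (\<Sum>i\<in>F \<union> B. fps_nth (f i) n)"
    using F(3)[of "F \<union> B"] F(1,2) assms(2,3) by (simp add: fps_sum_nth)
  also have "\<dots> = (\<Sum>i\<in>B. fps_nth (f i) n)"
    by (rule sum.mono_neutral_right) (use F assms in auto)
  finally show ?thesis .
qed

lemma fps_X_power_dvdI:
  assumes "\<And>n. n < N \<Longrightarrow> fps_nth f n = 0"
  shows "fps_X ^ N dvd (f :: 'a::comm_ring_1 fps)"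
proof
  show "f = fps_X ^ N * fps_shift N f"
    by (rule fps_ext) (use assms in \<open>auto simp: fps_X_power_mult_nth\<close>)
qed

lemma fps_X_power_dvd_has_sum_minus_1:
  fixes f :: "'b \<Rightarrow> 'a::comm_ring_1 fps"
  assumes "(f has_sum s) A" "z \<in> A" "f z = 1"
    and "\<And>i n. i \<in> A - {z} \<Longrightarrow> n < N \<Longrightarrow> fps_nth (f i) n = 0"
  shows "fps_X ^ N dvd s - 1"
proof (rule fps_X_power_dvdI)
  fix n assume "n < N"
  hence "fps_nth s n = (\<Sum>i\<in>{z}. fps_nth (f i) n)"
    using assms by (intro has_sum_fps_nth) auto
  thus "fps_nth (s - 1) n = 0"
    using assms(3) by simp
qed


section \<open>Contiguous relations\<close>

locale contiguous =
  fixes q x :: "'a::idom" and S :: "nat \<Rightarrow> nat \<Rightarrow> nat \<Rightarrow> nat \<Rightarrow> 'a"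
  assumes rel_a: "S \<alpha> \<beta> \<gamma> \<delta> = S (\<alpha> + 1) \<beta> \<gamma> \<delta> + x * q ^ (\<alpha> + 1) * S (\<alpha> + 2) (\<beta> + 2) (\<gamma> + 1) (\<delta> + 1)"
    and rel_b: "S \<alpha> \<beta> \<gamma> \<delta> = S \<alpha> (\<beta> + 1) \<gamma> \<delta> + x * q ^ (\<beta> + 1) * S (\<alpha> + 2) (\<beta> + 2) (\<gamma> + 1) (\<delta> + 1)"
    and rel_c: "S \<alpha> \<beta> \<gamma> \<delta> = S \<alpha> \<beta> (\<gamma> + 1) \<delta>
                  + x ^ 2 * q ^ (3 * \<gamma> + 3) * S (\<alpha> + 3) (\<beta> + 3) (\<gamma> + 2) (\<delta> + 2)"
    and rel_d: "S \<alpha> \<beta> \<gamma> \<delta> = S \<alpha> \<beta> \<gamma> (\<delta> + 1)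
                  + x ^ 2 * q ^ (3 * \<delta> + 3) * S (\<alpha> + 3) (\<beta> + 3) (\<gamma> + 2) (\<delta> + 2)"
begin

text \<open>Replacing x by x q^(3j) multiplies x^(a+b+2c+2d) by q^(3j(a+b) + 6j(c+d)). Since
  \<gamma> and \<delta> enter the exponent with a factor 3, the parameters move by 3j, 3j, 2j,
  2j.\<close>

lemma shift: "contiguous q (x * q ^ (3 * j))
  (\<lambda>\<alpha> \<beta> \<gamma> \<delta>. S (\<alpha> + 3 * j) (\<beta> + 3 * j) (\<gamma> + 2 * j) (\<delta> + 2 * j))"
proof
  fix \<alpha> \<beta> \<gamma> \<delta>
  note simps = power_add power_mult power_mult_distrib algebra_simps eval_nat_numeral
  show "S (\<alpha> + 3 * j) (\<beta> + 3 * j) (\<gamma> + 2 * j) (\<delta> + 2 * j) =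
      S (\<alpha> + 1 + 3 * j) (\<beta> + 3 * j) (\<gamma> + 2 * j) (\<delta> + 2 * j) +
      x * q ^ (3 * j) * q ^ (\<alpha> + 1) * S (\<alpha> + 2 + 3 * j) (\<beta> + 2 + 3 * j) (\<gamma> + 1 + 2 * j) (\<delta> + 1 + 2 * j)"
    using rel_a[of "\<alpha> + 3 * j" "\<beta> + 3 * j" "\<gamma> + 2 * j" "\<delta> + 2 * j"] by (simp add: simps)
  show "S (\<alpha> + 3 * j) (\<beta> + 3 * j) (\<gamma> + 2 * j) (\<delta> + 2 * j) =
      S (\<alpha> + 3 * j) (\<beta> + 1 + 3 * j) (\<gamma> + 2 * j) (\<delta> + 2 * j) +
      x * q ^ (3 * j) * q ^ (\<beta> + 1) * S (\<alpha> + 2 + 3 * j) (\<beta> + 2 + 3 * j) (\<gamma> + 1 + 2 * j) (\<delta> + 1 + 2 * j)"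
    using rel_b[of "\<alpha> + 3 * j" "\<beta> + 3 * j" "\<gamma> + 2 * j" "\<delta> + 2 * j"] by (simp add: simps)
  show "S (\<alpha> + 3 * j) (\<beta> + 3 * j) (\<gamma> + 2 * j) (\<delta> + 2 * j) =
      S (\<alpha> + 3 * j) (\<beta> + 3 * j) (\<gamma> + 1 + 2 * j) (\<delta> + 2 * j) +
      (x * q ^ (3 * j)) ^ 2 * q ^ (3 * \<gamma> + 3) *
        S (\<alpha> + 3 + 3 * j) (\<beta> + 3 + 3 * j) (\<gamma> + 2 + 2 * j) (\<delta> + 2 + 2 * j)"
    using rel_c[of "\<alpha> + 3 * j" "\<beta> + 3 * j" "\<gamma> + 2 * j" "\<delta> + 2 * j"] by (simp add: simps)
  show "S (\<alpha> + 3 * j) (\<beta> + 3 * j) (\<gamma> + 2 * j) (\<delta> + 2 * j) =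
      S (\<alpha> + 3 * j) (\<beta> + 3 * j) (\<gamma> + 2 * j) (\<delta> + 1 + 2 * j) +
      (x * q ^ (3 * j)) ^ 2 * q ^ (3 * \<delta> + 3) *
        S (\<alpha> + 3 + 3 * j) (\<beta> + 3 + 3 * j) (\<gamma> + 2 + 2 * j) (\<delta> + 2 + 2 * j)"
    using rel_d[of "\<alpha> + 3 * j" "\<beta> + 3 * j" "\<gamma> + 2 * j" "\<delta> + 2 * j"] by (simp add: simps)
qed

text \<open>Reduction to \<open>S 3 3 2 2\<close>, \<open>S 4 5 3 3\<close> and
  \<open>S 6 6 4 4\<close>, which later become \<open>f1 (j + 1)\<close>, \<open>w (j + 1)\<close>
  and \<open>f1 (j + 2)\<close>.\<close>

lemma S_2222:
  "S 2 2 2 2 = S 3 3 2 2 + 2 * x * q ^ 3 * S 4 5 3 3 + x ^ 2 * q ^ 8 * S 6 6 4 4"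
  and S_3222: "S 3 2 2 2 = S 3 3 2 2 + x * q ^ 3 * S 4 5 3 3"
proof -
  \<comment> \<open>When the first two parameters are equal, \<open>rel_a\<close> and
    \<open>rel_b\<close> have the same remainder, so raising either one gives the same
    value.\<close>
  have "S 7 6 4 4 = S 6 7 4 4"
    using rel_a[of 6 6 4 4] rel_b[of 6 6 4 4] by simp
  hence "S 5 4 3 3 = S 4 5 3 3"
    using rel_b[of 5 4 3 3] rel_a[of 4 5 3 3] by simp
  moreover have "S 3 2 2 2 = S 3 3 2 2 + x * q ^ 3 * S 5 4 3 3"
    using rel_b[of 3 2 2 2] by simp
  ultimately show *: "S 3 2 2 2 = S 3 3 2 2 + x * q ^ 3 * S 4 5 3 3"
    by simp
  have **: "S 2 2 2 2 = S 3 2 2 2 + x * q ^ 3 * S 4 4 3 3" "S 4 4 3 3 = S 4 5 3 3 + x * q ^ 5 * S 6 6 4 4"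
    using rel_a[of 2 2 2 2] rel_b[of 4 4 3 3] by simp_all
  show "S 2 2 2 2 = S 3 3 2 2 + 2 * x * q ^ 3 * S 4 5 3 3 + x ^ 2 * q ^ 8 * S 6 6 4 4"
    unfolding * ** by algebra
qed

text \<open>The parameters are raised one at a time from 0 0 0 0 to 1 2 1 1; the remainders are then
  reduced to the same three values.\<close>

lemma S_0000:
  "S 0 0 0 0 = S 1 2 1 1 + (2 * x * q + x * q ^ 2 + 2 * x ^ 2 * q ^ 3) * S 3 3 2 2
     + 3 * x ^ 2 * q ^ 4 * S 4 5 3 3 + (x ^ 3 * q ^ 9 - x ^ 4 * q ^ 12) * S 6 6 4 4"
proof -
  have "S 0 0 0 0 = S 0 0 1 0 + x ^ 2 * q ^ 3 * S 3 3 2 2"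
       "S 0 0 1 0 = S 0 0 1 1 + x ^ 2 * q ^ 3 * S 3 3 3 2"
       "S 3 3 3 2 = S 3 3 2 2 - x ^ 2 * q ^ 9 * S 6 6 4 4"
       "S 0 0 1 1 = S 1 0 1 1 + x * q * S 2 2 2 2"
       "S 1 0 1 1 = S 1 1 1 1 + x * q * S 3 2 2 2"
       "S 1 1 1 1 = S 1 2 1 1 + x * q ^ 2 * S 3 3 2 2"
    using rel_c[of 0 0 0 0] rel_d[of 0 0 1 0] rel_c[of 3 3 2 2]
          rel_a[of 0 0 1 1] rel_b[of 1 0 1 1] rel_b[of 1 1 1 1]
    by (simp_all add: eval_nat_numeral)
  note eqs = this
  show ?thesis
    unfolding eqs S_2222 S_3222 by algebra
qed

text \<open>On the way from 1 2 1 1 to 2 2 2 2, the multiples of \<open>S 5 5 3 3\<close> coming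
  from \<open>S 3 4 2 2\<close> and \<open>S 2 2 1 1\<close> cancel, as do those of
  \<open>S 8 8 5 5\<close> coming from \<open>S 5 5 4 3\<close> and
  \<open>S 6 7 4 4\<close>.\<close>

lemma S_1211:
  "S 1 2 1 1 = (1 + x * q ^ 2) * S 3 3 2 2 + (2 * x * q ^ 3 + x ^ 2 * q ^ 6) * S 4 5 3 3
     + (x ^ 2 * q ^ 8 - x ^ 3 * q ^ 11) * S 6 6 4 4"
proof -
  have "S 1 2 1 1 = S 2 2 1 1 + x * q ^ 2 * S 3 4 2 2"
       "S 3 4 2 2 = S 3 3 2 2 - x * q ^ 4 * S 5 5 3 3"
       "S 2 2 1 1 = S 2 2 2 1 + x ^ 2 * q ^ 6 * S 5 5 3 3"
       "S 2 2 2 1 = S 2 2 2 2 + x ^ 2 * q ^ 6 * S 5 5 4 3"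
       "S 5 5 4 3 = S 5 5 3 3 - x ^ 2 * q ^ 12 * S 8 8 5 5"
       "S 5 5 3 3 = S 4 5 3 3 - x * q ^ 5 * S 6 7 4 4"
       "S 6 7 4 4 = S 6 6 4 4 - x * q ^ 7 * S 8 8 5 5"
    using rel_a[of 1 2 1 1] rel_b[of 3 3 2 2] rel_c[of 2 2 1 1] rel_d[of 2 2 2 1]
          rel_c[of 5 5 3 3] rel_a[of 4 5 3 3] rel_b[of 6 6 4 4]
    by (simp_all add: eval_nat_numeral)
  note eqs = this
  show ?thesis
    unfolding eqs S_2222 by algebra
qed

end

text \<open>\<open>f1 j\<close>, \<open>f2 j\<close>, \<open>f3 j\<close> stand for the generating functions of the partitions
  all of whose parts have content at least \<open>3 j + 1\<close>, \<open>3 j + 2\<close>, \<open>3 j + 3\<close>, respectively,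
  and \<open>g\<close> for that of the partitions that may follow the smallest part \<open>Ordinary (3 j + 3)\<close>.\<close>

definition qdiff_system :: "'a::comm_ring_1 \<Rightarrow> 'a \<Rightarrow> (nat \<Rightarrow> 'a) \<Rightarrow> (nat \<Rightarrow> 'a) \<Rightarrow> (nat \<Rightarrow> 'a) \<Rightarrow> bool" where
  "qdiff_system q x f1 f2 f3 \<longleftrightarrow> (\<forall>j. let t = x * q ^ (3 * j); g = f3 (j + 1) + t * q ^ 5 * f1 (j + 2) in
     f1 j = f2 j + t * q * (f1 (j + 1) + t * q ^ 3 * g + t * q ^ 2 * f1 (j + 1))
              + t * q * (f1 (j + 1) + t * q ^ 3 * f2 (j + 1) + t * q ^ 3 * g
                         + t * q ^ 2 * (f1 (j + 1) - t ^ 2 * q ^ 9 * f1 (j + 2))) \<and>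
     f2 j = f3 j + 2 * t * q ^ 2 * f1 (j + 1) \<and>
     f3 j = f1 (j + 1) + t * q ^ 3 * (f2 (j + 1) + t * q ^ 3 * f3 (j + 1)) + t * q ^ 3 * g)"

text \<open>Placing the second and third components symmetrically around \<open>w\<close> settles
  the second equation and turns \<open>g\<close> into \<open>w (j + 1)\<close>. The first and third
  equations are then \<open>S_0000\<close> and \<open>S_1211\<close> for the shifted family.\<close>

lemma (in contiguous) qdiff_system_S:
  defines "f1 \<equiv> \<lambda>j. S (3 * j) (3 * j) (2 * j) (2 * j)"
    and "w \<equiv> \<lambda>j. S (3 * j + 1) (3 * j + 2) (2 * j + 1) (2 * j + 1)"
  shows "qdiff_system q x f1
    (\<lambda>j. w j + x * q ^ (3 * j + 2) * f1 (j + 1)) (\<lambda>j. w j - x * q ^ (3 * j + 2) * f1 (j + 1))"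
  unfolding qdiff_system_def
proof
  fix j
  define t where "t = x * q ^ (3 * j)"
  interpret s: contiguous q t "\<lambda>\<alpha> \<beta> \<gamma> \<delta>. S (\<alpha> + 3 * j) (\<beta> + 3 * j) (\<gamma> + 2 * j) (\<delta> + 2 * j)"
    unfolding t_def by (rule shift)
  have f1_eqs: "S (0 + 3 * j) (0 + 3 * j) (0 + 2 * j) (0 + 2 * j) = f1 j"
       "S (3 + 3 * j) (3 + 3 * j) (2 + 2 * j) (2 + 2 * j) = f1 (j + 1)"
       "S (6 + 3 * j) (6 + 3 * j) (4 + 2 * j) (4 + 2 * j) = f1 (j + 2)"
    by (simp_all add: f1_def eval_nat_numeral)
  have w_eqs: "S (1 + 3 * j) (2 + 3 * j) (1 + 2 * j) (1 + 2 * j) = w j"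
       "S (4 + 3 * j) (5 + 3 * j) (3 + 2 * j) (3 + 2 * j) = w (j + 1)"
    by (simp_all add: w_def eval_nat_numeral)
  have w: "w j = (1 + t * q ^ 2) * f1 (j + 1) + (2 * t * q ^ 3 + t ^ 2 * q ^ 6) * w (j + 1)
     + (t ^ 2 * q ^ 8 - t ^ 3 * q ^ 11) * f1 (j + 2)"
    using s.S_1211 unfolding f1_eqs w_eqs .
  have f: "f1 j = w j + (2 * t * q + t * q ^ 2 + 2 * t ^ 2 * q ^ 3) * f1 (j + 1)
     + 3 * t ^ 2 * q ^ 4 * w (j + 1) + (t ^ 3 * q ^ 9 - t ^ 4 * q ^ 12) * f1 (j + 2)"
    using s.S_0000 unfolding f1_eqs w_eqs .
  have t: "x * q ^ (3 * j + 2) = t * q ^ 2" "x * q ^ (3 * (j + 1) + 2) = t * q ^ 5" "j + 1 + 1 = j + 2"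
    by (simp_all add: t_def power_add mult.assoc eval_nat_numeral)
  show "let t = x * q ^ (3 * j);
      g = w (j + 1) - x * q ^ (3 * (j + 1) + 2) * f1 (j + 1 + 1) + t * q ^ 5 * f1 (j + 2) in
     f1 j = w j + x * q ^ (3 * j + 2) * f1 (j + 1) + t * q * (f1 (j + 1) + t * q ^ 3 * g + t * q ^ 2 * f1 (j + 1))
              + t * q * (f1 (j + 1) + t * q ^ 3 * (w (j + 1) + x * q ^ (3 * (j + 1) + 2) * f1 (j + 1 + 1))
                + t * q ^ 3 * g + t * q ^ 2 * (f1 (j + 1) - t ^ 2 * q ^ 9 * f1 (j + 2))) \<and>
     w j + x * q ^ (3 * j + 2) * f1 (j + 1) = w j - x * q ^ (3 * j + 2) * f1 (j + 1) + 2 * t * q ^ 2 * f1 (j + 1) \<and>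
     w j - x * q ^ (3 * j + 2) * f1 (j + 1) = f1 (j + 1)
       + t * q ^ 3 * (w (j + 1) + x * q ^ (3 * (j + 1) + 2) * f1 (j + 1 + 1)
         + t * q ^ 3 * (w (j + 1) - x * q ^ (3 * (j + 1) + 2) * f1 (j + 1 + 1))) + t * q ^ 3 * g"
    unfolding Let_def t t_def[symmetric]
  proof (intro conjI)
    show "f1 j = w j + t * q\<^sup>2 * f1 (j + 1) +
        t * q * (f1 (j + 1) + t * q ^ 3 * (w (j + 1) - t * q ^ 5 * f1 (j + 2) + t * q ^ 5 * f1 (j + 2)) + t * q\<^sup>2 * f1 (j + 1)) +
        t * q * (f1 (j + 1) + t * q ^ 3 * (w (j + 1) + t * q ^ 5 * f1 (j + 2)) +
         t * q ^ 3 * (w (j + 1) - t * q ^ 5 * f1 (j + 2) + t * q ^ 5 * f1 (j + 2)) +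
         t * q\<^sup>2 * (f1 (j + 1) - t\<^sup>2 * q ^ 9 * f1 (j + 2)))"
      unfolding f by algebra
    show "w j + t * q\<^sup>2 * f1 (j + 1) = w j - t * q\<^sup>2 * f1 (j + 1) + 2 * t * q\<^sup>2 * f1 (j + 1)"
      by algebra
    show "w j - t * q\<^sup>2 * f1 (j + 1) = f1 (j + 1) +
        t * q ^ 3 * (w (j + 1) + t * q ^ 5 * f1 (j + 2) + t * q ^ 3 * (w (j + 1) - t * q ^ 5 * f1 (j + 2))) +
        t * q ^ 3 * (w (j + 1) - t * q ^ 5 * f1 (j + 2) + t * q ^ 5 * f1 (j + 2))"
      unfolding w by algebra
  qed
qed

section \<open>Uniqueness for the q-difference system\<close>

text \<open>The differences solve a homogeneous system in which index j is determined by j + 1 and j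
  + 2. Divisibility by q^N is given for j \<ge> N and descends to all j, for every N.\<close>

lemma qdiff_system_unique:
  fixes f1 f2 f3 g1 g2 g3 :: "nat \<Rightarrow> 'a::idom fps"
  assumes f: "qdiff_system fps_X x f1 f2 f3" and g: "qdiff_system fps_X x g1 g2 g3"
    and 1: "\<And>j. fps_X ^ j dvd f1 j - g1 j"
    and 2: "\<And>j. fps_X ^ j dvd f2 j - g2 j"
    and 3: "\<And>j. fps_X ^ j dvd f3 j - g3 j"
  shows "f1 = g1" "f2 = g2" "f3 = g3"
proof -
  define q :: "'a fps" where "q = fps_X"
  have *: "q ^ N dvd f1 j - g1 j \<and> q ^ N dvd f2 j - g2 j \<and> q ^ N dvd f3 j - g3 j" for N j
  proof (induction "N - j" arbitrary: j rule: less_induct)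
    case (less j)
    show ?case
    proof (cases "j < N")
      case False
      thus ?thesis
        unfolding q_def using 1 2 3 by (meson dvd_trans le_imp_power_dvd not_less)
    next
      case True
      define t where "t = x * q ^ (3 * j)"
      note IH = less[of "j + 1"] less[of "j + 2"]
      note f_eqs = f[unfolded qdiff_system_def Let_def, rule_format, of j, folded q_def, folded t_def]
      note g_eqs = g[unfolded qdiff_system_def Let_def, rule_format, of j, folded q_def, folded t_def]
      note f1 = f_eqs[THEN conjunct1] and f2 = f_eqs[THEN conjunct2, THEN conjunct1]
        and f3 = f_eqs[THEN conjunct2, THEN conjunct2]
      note g1 = g_eqs[THEN conjunct1] and g2 = g_eqs[THEN conjunct2, THEN conjunct1]
        and g3 = g_eqs[THEN conjunct2, THEN conjunct2]
      \<comment> \<open>The order f3, f2, f1 matters: f2 involves f3, and f1 involves f2, at the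
        same index j.\<close>
      have "f3 j - g3 j = (f1 (j + 1) - g1 (j + 1)) + t * q ^ 3 * (f2 (j + 1) - g2 (j + 1))
          + (t ^ 2 * q ^ 6 + t * q ^ 3) * (f3 (j + 1) - g3 (j + 1)) + t ^ 2 * q ^ 8 * (f1 (j + 2) - g1 (j + 2))"
        unfolding f3 g3 by algebra
      hence 3: "q ^ N dvd f3 j - g3 j"
        using IH True by auto
      have "f2 j - g2 j = (f3 j - g3 j) + 2 * t * q ^ 2 * (f1 (j + 1) - g1 (j + 1))"
        unfolding f2 g2 by algebra
      hence 2: "q ^ N dvd f2 j - g2 j"
        using IH True 3 by auto
      have "f1 j - g1 j = (f2 j - g2 j) + (2 * t * q + 2 * t ^ 2 * q ^ 3) * (f1 (j + 1) - g1 (j + 1))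
          + 2 * t ^ 2 * q ^ 4 * (f3 (j + 1) - g3 (j + 1)) + t ^ 2 * q ^ 4 * (f2 (j + 1) - g2 (j + 1))
          + (2 * t ^ 3 * q ^ 9 - t ^ 4 * q ^ 12) * (f1 (j + 2) - g1 (j + 2))"
        unfolding f1 g1 by algebra
      hence "q ^ N dvd f1 j - g1 j"
        using IH True 2 by auto
      with 2 3 show ?thesis
        by simp
    qed
  qed
  have "h = 0" if h: "\<And>N. q ^ N dvd h" for h
  proof (rule fps_ext)
    fix n
    obtain g where "h = q ^ Suc n * g"
      using h[of "Suc n"] by (elim dvdE)
    thus "fps_nth h n = fps_nth 0 n"
      by (simp add: q_def fps_X_power_mult_nth del: power_Suc)
  qed
  hence "f1 j - g1 j = 0" "f2 j - g2 j = 0" "f3 j - g3 j = 0" for j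
    using * by blast+
  thus "f1 = g1" "f2 = g2" "f3 = g3"
    by auto
qed


section \<open>The multisum side\<close>

text \<open>In the applications \<phi> increments one summation index. Off its range that index is
  zero and f, g agree; on its range their difference is the reindexed \<open>c * h\<close>.\<close>

lemma infsum_contiguous:
  fixes f g h :: "'b \<Rightarrow> 'a::comm_ring_1 fps"
  assumes "g summable_on UNIV" "h summable_on UNIV" "inj \<phi>"
    and "\<And>i. i \<notin> range \<phi> \<Longrightarrow> f i = g i"
    and "\<And>i. f (\<phi> i) = g (\<phi> i) + c * h i"
  shows "infsum f UNIV = infsum g UNIV + c * infsum h UNIV"
proof -
  have "((\<lambda>i. c * h i) has_sum c * infsum h UNIV) UNIV"
    using assms(2) by (intro has_sum_cmult_right) simp
  also have "(\<lambda>i. c * h i) = (\<lambda>i. f i - g i) \<circ> \<phi>"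
    using assms(5) by auto
  finally have "((\<lambda>i. f i - g i) has_sum c * infsum h UNIV) (range \<phi>)"
    by (subst has_sum_reindex[OF assms(3)])
  hence "((\<lambda>i. f i - g i) has_sum c * infsum h UNIV) UNIV"
    by (rule has_sum_cong_neutral[THEN iffD1, rotated 3]) (use assms(4) in auto)
  hence "((\<lambda>i. g i + (f i - g i)) has_sum infsum g UNIV + c * infsum h UNIV) UNIV"
    using assms(1) by (intro has_sum_add) simp_all
  thus ?thesis
    by (intro infsumI) simp
qed

section \<open>Inverses of q-Pochhammer symbols\<close>

text \<open>The coefficients lie in \<open>rat fps\<close>, which is not a field; the constant term
  1 is a unit there, so \<open>inverse\<close> is a genuine inverse.\<close>

lemma mult_inverse_fps:
  fixes f :: "rat fps fps"
  assumes "fps_nth f 0 = 1"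
  shows "f * inverse f = 1"
  using fps_right_inverse[of f 1] unfolding fps_inverse_def[of f] assms fps_inverse_one by simp

lemma inverse_mult_fps:
  fixes f g :: "rat fps fps"
  assumes "fps_nth f 0 = 1" "fps_nth g 0 = 1"
  shows "inverse (f * g) = inverse f * inverse g"
proof -
  have "(f * g) * (inverse f * inverse g) = (f * g) * inverse (f * g)"
    using mult_inverse_fps[of f] mult_inverse_fps[of g] mult_inverse_fps[of "f * g"] assms
    by (simp add: algebra_simps)
  moreover have "f * g \<noteq> 0"
    using assms by auto
  ultimately show ?thesis
    by simp
qed

definition qpoch_inv :: "nat \<Rightarrow> nat \<Rightarrow> rat fps fps" where
  "qpoch_inv s n = inverse (qpoch (q_var ^ s) (q_var ^ s) n)"

lemma qpoch_nth_0: "s > 0 \<Longrightarrow> fps_nth (qpoch (q_var ^ s) (q_var ^ s) n) 0 = 1"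
  by (induction n) (auto simp: qpoch_def)

lemma qpoch_inv_0 [simp]: "qpoch_inv s 0 = 1"
  using mult_inverse_fps[of 1] by (simp add: qpoch_inv_def qpoch_def)

text \<open>Cancelling the last factor 1 - q^(s(n+1)) of the longer product gives the identity
  behind all four contiguous relations.\<close>

lemma qpoch_inv_Suc:
  assumes "s > 0"
  shows "qpoch_inv s (Suc n) = qpoch_inv s n + q_var ^ (s * Suc n) * qpoch_inv s (Suc n)"
proof -
  let ?p = "qpoch (q_var ^ s) (q_var ^ s)"
  have 1: "?p n * qpoch_inv s n = 1" "?p (Suc n) * qpoch_inv s (Suc n) = 1"
    using assms by (auto simp: qpoch_inv_def qpoch_nth_0 intro!: mult_inverse_fps)
  have 2: "?p (Suc n) = ?p n * (1 - q_var ^ (s * Suc n))"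
    by (simp add: qpoch_def power_mult power_add)
  have "qpoch_inv s n = qpoch_inv s n * (?p (Suc n) * qpoch_inv s (Suc n))"
    using 1 by simp
  also have "\<dots> = (?p n * qpoch_inv s n) * ((1 - q_var ^ (s * Suc n)) * qpoch_inv s (Suc n))"
    by (simp only: 2 mult_ac)
  also have "\<dots> = (1 - q_var ^ (s * Suc n)) * qpoch_inv s (Suc n)"
    using 1 by simp
  finally show ?thesis
    by (simp add: algebra_simps)
qed

section \<open>The quadruple sum and its contiguous relations\<close>

text \<open>This is (a+b)^2 + 3(a+b)(c+d) + 3(c+d)^2, hence symmetric in a, b and in c, d.\<close>

definition energy :: "nat \<times> nat \<times> nat \<times> nat \<Rightarrow> nat" where
  "energy = (\<lambda>(a, b, c, d). a^2 + b^2 + 3*c^2 + 3*d^2 + 2*a*b + 3*a*c + 3*a*d + 3*b*c + 3*b*d + 6*c*d)"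

definition summand :: "rat fps fps \<Rightarrow> nat \<Rightarrow> nat \<Rightarrow> nat \<Rightarrow> nat \<Rightarrow> nat \<times> nat \<times> nat \<times> nat \<Rightarrow> rat fps fps" where
  "summand x \<alpha> \<beta> \<gamma> \<delta> = (\<lambda>(a, b, c, d).
     q_var ^ (energy (a, b, c, d) + \<alpha> * a + \<beta> * b + 3 * \<gamma> * c + 3 * \<delta> * d) * x ^ (a + b + 2 * c + 2 * d)
     * (qpoch_inv 1 a * qpoch_inv 1 b * qpoch_inv 3 c * qpoch_inv 3 d))"

lemma summand_nth_eq_0:
  assumes "n < energy (a, b, c, d) + \<alpha> * a + \<beta> * b + 3 * \<gamma> * c + 3 * \<delta> * d"
  shows "fps_nth (summand x \<alpha> \<beta> \<gamma> \<delta> (a, b, c, d)) n = 0"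
  using assms by (simp add: summand_def mult.assoc fps_X_power_mult_nth del: power_Suc)

lemma energy_ge:
  "a \<le> energy (a, b, c, d) \<and> b \<le> energy (a, b, c, d) \<and> c \<le> energy (a, b, c, d) \<and> d \<le> energy (a, b, c, d)"
proof -
  have "m \<le> m ^ 2" for m :: nat
    by (simp add: power2_eq_square)
  from this[of a] this[of b] this[of c] this[of d] show ?thesis
    by (simp add: energy_def)
qed

text \<open>By \<open>energy_ge\<close>, only indices with all four entries at most n contribute to
  q^n.\<close>

lemma summand_summable: "summand x \<alpha> \<beta> \<gamma> \<delta> summable_on UNIV"
proof (rule summable_on_fps)
  fix n
  have "{i. fps_nth (summand x \<alpha> \<beta> \<gamma> \<delta> i) n \<noteq> 0} \<subseteq> {..n} \<times> {..n} \<times> {..n} \<times> {..n}"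
  proof
    fix i assume i: "i \<in> {i. fps_nth (summand x \<alpha> \<beta> \<gamma> \<delta> i) n \<noteq> 0}"
    obtain a b c d where abcd: "i = (a, b, c, d)"
      by (cases i)
    have "energy (a, b, c, d) \<le> n"
    proof (rule ccontr)
      assume "\<not> energy (a, b, c, d) \<le> n"
      hence "fps_nth (summand x \<alpha> \<beta> \<gamma> \<delta> (a, b, c, d)) n = 0"
        by (intro summand_nth_eq_0) simp
      with i show False
        by (simp add: abcd)
    qed
    thus "i \<in> {..n} \<times> {..n} \<times> {..n} \<times> {..n}"
      using energy_ge[of a b c d] by (simp add: abcd)
  qed
  thus "finite {i \<in> UNIV. fps_nth (summand x \<alpha> \<beta> \<gamma> \<delta> i) n \<noteq> 0}"
    by (auto intro: finite_subset)
qed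

definition multisum :: "rat fps fps \<Rightarrow> nat \<Rightarrow> nat \<Rightarrow> nat \<Rightarrow> nat \<Rightarrow> rat fps fps" where
  "multisum x \<alpha> \<beta> \<gamma> \<delta> = infsum (summand x \<alpha> \<beta> \<gamma> \<delta>) UNIV"

text \<open>Here \<open>p1\<close> and \<open>p0\<close> are the products of inverse Pochhammer
  symbols with and without the increment of one index, m is the exponent from
  \<open>qpoch_inv_Suc\<close>, and \<open>e1\<close>, \<open>e2\<close>, \<open>e3\<close> are the
  exponents of q in the three summands.\<close>

lemma contiguous_step:
  fixes q :: "'a::comm_ring_1"
  assumes "p1 = p0 + q ^ m * p1" "e2 = e1 + m" "c * (q ^ e3 * x3) = q ^ e1 * x1"
  shows "q ^ e1 * x1 * p1 = q ^ e2 * x1 * p1 + c * (q ^ e3 * x3 * p0)"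
proof -
  have "q ^ e1 * x1 * p1 = q ^ e1 * x1 * (p0 + q ^ m * p1)"
    using assms(1) by simp
  also have "\<dots> = q ^ e2 * x1 * p1 + c * (q ^ e3 * x3) * p0"
    unfolding assms(2,3) by (simp add: algebra_simps power_add)
  finally show ?thesis
    by (simp add: mult.assoc)
qed

lemma multisum_swap:
  "multisum x \<alpha> \<beta> \<gamma> \<delta> = multisum x \<beta> \<alpha> \<gamma> \<delta>"
  "multisum x \<alpha> \<beta> \<gamma> \<delta> = multisum x \<alpha> \<beta> \<delta> \<gamma>"
proof -
  show "multisum x \<alpha> \<beta> \<gamma> \<delta> = multisum x \<beta> \<alpha> \<gamma> \<delta>"
    unfolding multisum_def
    by (rule infsum_reindex_bij_witness[of _ "\<lambda>(a, b, c, d). (b, a, c, d)" "\<lambda>(a, b, c, d). (b, a, c, d)"])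
       (auto simp: summand_def energy_def algebra_simps)
  show "multisum x \<alpha> \<beta> \<gamma> \<delta> = multisum x \<alpha> \<beta> \<delta> \<gamma>"
    unfolding multisum_def
    by (rule infsum_reindex_bij_witness[of _ "\<lambda>(a, b, c, d). (a, b, d, c)" "\<lambda>(a, b, c, d). (a, b, d, c)"])
       (auto simp: summand_def energy_def algebra_simps)
qed

lemma contiguous_multisum: "contiguous q_var x (multisum x)"
proof
  fix \<alpha> \<beta> \<gamma> \<delta> :: nat
  note simps = energy_def algebra_simps power2_eq_square power_add
  \<comment> \<open>Incrementing a raises \<open>energy\<close> by 1 + 2a + 2b + 3c + 3d: the
    constant goes into the prefactor, the rest shifts the parameters by 2, 2, 1, 1.\<close>
  show rel_a: "multisum x \<alpha> \<beta> \<gamma> \<delta> = multisum x (\<alpha> + 1) \<beta> \<gamma> \<delta>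
          + x * q_var ^ (\<alpha> + 1) * multisum x (\<alpha> + 2) (\<beta> + 2) (\<gamma> + 1) (\<delta> + 1)" for \<alpha> \<beta>
    unfolding multisum_def
  proof (rule infsum_contiguous[OF summand_summable summand_summable, where \<phi> = "\<lambda>(a, b, c, d). (Suc a, b, c, d)"])
    fix i :: "nat \<times> nat \<times> nat \<times> nat"
    obtain a b c d where i: "i = (a, b, c, d)"
      by (cases i)
    show "summand x \<alpha> \<beta> \<gamma> \<delta> i = summand x (\<alpha> + 1) \<beta> \<gamma> \<delta> i"
      if "i \<notin> range (\<lambda>(a, b, c, d). (Suc a, b, c, d))"
    proof -
      have "a = 0"
      proof (rule ccontr)
        assume "a \<noteq> 0"
        hence "i = (\<lambda>(a, b, c, d). (Suc a, b, c, d)) (a - 1, b, c, d)"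
          by (simp add: i)
        with that show False
          by blast
      qed
      thus ?thesis
        by (simp add: i summand_def)
    qed
    show "summand x \<alpha> \<beta> \<gamma> \<delta> (case i of (a, b, c, d) \<Rightarrow> (Suc a, b, c, d)) =
            summand x (\<alpha> + 1) \<beta> \<gamma> \<delta> (case i of (a, b, c, d) \<Rightarrow> (Suc a, b, c, d))
            + x * q_var ^ (\<alpha> + 1) * summand x (\<alpha> + 2) (\<beta> + 2) (\<gamma> + 1) (\<delta> + 1) i"
      unfolding i summand_def prod.case
      by (rule contiguous_step[where m = "Suc a"], subst qpoch_inv_Suc[of 1 a]) (simp_all add: simps)
  qed (auto simp: inj_def)
  \<comment> \<open>Incrementing c raises \<open>energy\<close> by 3 + 3a + 3b + 6c + 6d, whence the
    shifts 3, 3, 2, 2.\<close>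
  show rel_c: "multisum x \<alpha> \<beta> \<gamma> \<delta> = multisum x \<alpha> \<beta> (\<gamma> + 1) \<delta>
          + x ^ 2 * q_var ^ (3 * \<gamma> + 3) * multisum x (\<alpha> + 3) (\<beta> + 3) (\<gamma> + 2) (\<delta> + 2)" for \<gamma> \<delta>
    unfolding multisum_def
  proof (rule infsum_contiguous[OF summand_summable summand_summable, where \<phi> = "\<lambda>(a, b, c, d). (a, b, Suc c, d)"])
    fix i :: "nat \<times> nat \<times> nat \<times> nat"
    obtain a b c d where i: "i = (a, b, c, d)"
      by (cases i)
    show "summand x \<alpha> \<beta> \<gamma> \<delta> i = summand x \<alpha> \<beta> (\<gamma> + 1) \<delta> i"
      if "i \<notin> range (\<lambda>(a, b, c, d). (a, b, Suc c, d))"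
    proof -
      have "c = 0"
      proof (rule ccontr)
        assume "c \<noteq> 0"
        hence "i = (\<lambda>(a, b, c, d). (a, b, Suc c, d)) (a, b, c - 1, d)"
          by (simp add: i)
        with that show False
          by blast
      qed
      thus ?thesis
        by (simp add: i summand_def)
    qed
    show "summand x \<alpha> \<beta> \<gamma> \<delta> (case i of (a, b, c, d) \<Rightarrow> (a, b, Suc c, d)) =
            summand x \<alpha> \<beta> (\<gamma> + 1) \<delta> (case i of (a, b, c, d) \<Rightarrow> (a, b, Suc c, d))
            + x ^ 2 * q_var ^ (3 * \<gamma> + 3) * summand x (\<alpha> + 3) (\<beta> + 3) (\<gamma> + 2) (\<delta> + 2) i"
      unfolding i summand_def prod.case
      by (rule contiguous_step[where m = "3 * Suc c"], subst qpoch_inv_Suc[of 3 c]) (simp_all add: simps)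
  qed (auto simp: inj_def)
  \<comment> \<open>The relations in \<beta> and \<delta> follow from those in \<alpha> and \<gamma>
    by symmetry.\<close>
  show "multisum x \<alpha> \<beta> \<gamma> \<delta> = multisum x \<alpha> (\<beta> + 1) \<gamma> \<delta>
          + x * q_var ^ (\<beta> + 1) * multisum x (\<alpha> + 2) (\<beta> + 2) (\<gamma> + 1) (\<delta> + 1)"
    using rel_a[of \<beta> \<alpha>] by (simp only: multisum_swap(1)[of x _ \<alpha>] multisum_swap(1)[of x _ "\<alpha> + 2"])
  show "multisum x \<alpha> \<beta> \<gamma> \<delta> = multisum x \<alpha> \<beta> \<gamma> (\<delta> + 1)
          + x ^ 2 * q_var ^ (3 * \<delta> + 3) * multisum x (\<alpha> + 3) (\<beta> + 3) (\<gamma> + 2) (\<delta> + 2)"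
    using rel_c[of \<delta> \<gamma>] by (simp only: multisum_swap(2)[of x _ _ _ \<gamma>] multisum_swap(2)[of x _ _ _ "\<gamma> + 2"])
qed

text \<open>A nonzero index adds at least N to the exponent through the linear form alone, so only
  the zero index, with term 1, contributes below q^N.\<close>

lemma multisum_minus_1_dvd:
  assumes "N \<le> \<alpha>" "N \<le> \<beta>" "N \<le> \<gamma>" "N \<le> \<delta>"
  shows "q_var ^ N dvd multisum x \<alpha> \<beta> \<gamma> \<delta> - 1"
proof (rule fps_X_power_dvd_has_sum_minus_1[where z = "(0, 0, 0, 0)"])
  show "(summand x \<alpha> \<beta> \<gamma> \<delta> has_sum multisum x \<alpha> \<beta> \<gamma> \<delta>) UNIV"
    unfolding multisum_def using summand_summable by simp
  show "summand x \<alpha> \<beta> \<gamma> \<delta> (0, 0, 0, 0) = 1"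
    by (simp add: summand_def energy_def)
  fix i n
  assume "i \<in> UNIV - {(0 :: nat, 0 :: nat, 0 :: nat, 0 :: nat)}" "n < N"
  moreover obtain a b c d where i: "i = (a, b, c, d)"
    by (cases i)
  ultimately consider "a > 0" | "b > 0" | "c > 0" | "d > 0"
    by auto
  hence "N \<le> \<alpha> * a + \<beta> * b + 3 * \<gamma> * c + 3 * \<delta> * d"
  proof cases
    case 1
    with assms have "N * 1 \<le> \<alpha> * a" by (intro mult_le_mono) auto
    thus ?thesis by simp
  next
    case 2
    with assms have "N * 1 \<le> \<beta> * b" by (intro mult_le_mono) auto
    thus ?thesis by simp
  next
    case 3
    with assms have "N * 1 \<le> (3 * \<gamma>) * c" by (intro mult_le_mono) auto
    thus ?thesis by simp
  next
    case 4
    with assms have "N * 1 \<le> (3 * \<delta>) * d" by (intro mult_le_mono) auto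
    thus ?thesis by simp
  qed
  thus "fps_nth (summand x \<alpha> \<beta> \<gamma> \<delta> i) n = 0"
    unfolding i using \<open>n < N\<close> by (intro summand_nth_eq_0) simp
qed simp


section \<open>The partition side\<close>

text \<open>Of two neighbours, p is the lower and r the upper one; the order, D1 and D2 are combined
  for the pair (r, p).\<close>

definition step :: "part \<Rightarrow> part \<Rightarrow> bool" where
  "step p r \<longleftrightarrow> p \<le> r
     \<and> (int (cont r) - int (cont p) \<le> 1 \<longrightarrow> 3 dvd cont r + cont p \<and> color r \<noteq> color p)
     \<and> (int (cont r) - int (cont p) = 2 \<and> \<not> 3 dvd cont r + cont p \<longrightarrow> (color r, color p) \<noteq> (Minus, Plus))"

text \<open>The patterns are those of D3 reversed. Only occurrences starting at p are tested; later
  ones are caught by the recursion in \<open>ascending\<close>.\<close>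

definition allowed :: "part \<Rightarrow> part list \<Rightarrow> bool" where
  "allowed p l \<longleftrightarrow> (l = [] \<or> step p (hd l)) \<and> (\<forall>k\<ge>1.
     \<not> prefix [Colored (3*k - 2), Colored (3*k), Ordinary (3*k)] (p # l) \<and>
     \<not> prefix [Colored (3*k), Ordinary (3*k), Ordinary (3*k + 2)] (p # l) \<and>
     \<not> prefix [Colored (3*k - 2), Ordinary (3*k - 1), Ordinary (3*k + 1), Colored (3*k + 2)] (p # l))"

text \<open>The recurrences remove the smallest part, so partitions are read backwards, in ascending order.\<close>

fun ascending :: "part list \<Rightarrow> bool" where
  "ascending [] \<longleftrightarrow> True"
| "ascending (p # l) \<longleftrightarrow> cont p \<ge> 1 \<and> allowed p l \<and> ascending l"

text \<open>Order, D1 and D2 constrain adjacent pairs only, and a forbidden factor occurs iff it is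
  a prefix of some tail.\<close>

lemma rev_in_R_iff: "rev l \<in> R \<longleftrightarrow> ascending l"
proof -
  have sorted: "sorted_wrt (\<ge>) m \<longleftrightarrow> successively (\<ge>) m" for m :: "part list"
    by (subst successively_conv_sorted_wrt) (auto simp: transp_def)
  have "sorted_wrt (\<ge>) m \<and> D1 m \<and> D2 m \<longleftrightarrow> successively (\<lambda>r p. step p r) m" for m
    unfolding sorted D1_def D2_def successively_conv_nth step_def by auto
  from this[of "rev l"] have "rev l \<in> R \<longleftrightarrow> successively step l \<and> (\<forall>p\<in>set l. cont p \<ge> 1) \<and> D3 (rev l)"
    unfolding R_def two_colored_partition_def mem_Collect_eq successively_rev set_rev by metis
  also have "D3 (rev l) \<longleftrightarrow> (\<forall>k\<ge>1.
     \<not> sublist [Colored (3*k - 2), Colored (3*k), Ordinary (3*k)] l \<and>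
     \<not> sublist [Colored (3*k), Ordinary (3*k), Ordinary (3*k + 2)] l \<and>
     \<not> sublist [Colored (3*k - 2), Ordinary (3*k - 1), Ordinary (3*k + 1), Colored (3*k + 2)] l)"
    unfolding D3_def sublist_rev_right by simp
  also have "successively step l \<and> (\<forall>p\<in>set l. cont p \<ge> 1) \<and> \<dots> \<longleftrightarrow> ascending l"
    by (induction l) (auto simp: sublist_Cons_right successively_Cons allowed_def simp del: Cons_prefix_Cons)
  finally show ?thesis .
qed

text \<open>For n = \<open>cont p\<close>, gaps 0, 1, 2 give content sums 2n, 2n + 1, 2n + 2.
  Exactly one is divisible by 3, namely that of gap 0, 1, 2 for n congruent to 0, 1, 2 modulo
  3.\<close>

lemma step_iff:
  "step (Ordinary (3 * k)) r \<longleftrightarrow> r = Ordinary (3 * k + 2) \<or> 3 * k + 3 \<le> cont r"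
  "step (Colored (3 * k)) r \<longleftrightarrow> r = Ordinary (3 * k) \<or> 3 * k + 2 \<le> cont r"
  "step (Ordinary (3 * k + 1)) r \<longleftrightarrow> r = Colored (3 * k + 2) \<or> r = Ordinary (3 * k + 3) \<or> 3 * k + 4 \<le> cont r"
  "step (Colored (3 * k + 1)) r \<longleftrightarrow> r = Ordinary (3 * k + 2) \<or> 3 * k + 3 \<le> cont r"
  "step (Ordinary (3 * k + 2)) r \<longleftrightarrow> 3 * k + 4 \<le> cont r"
  "step (Colored (3 * k + 2)) r \<longleftrightarrow> 3 * k + 4 \<le> cont r"
  by (cases r; simp add: step_def less_eq_part_def less_part_def; presburger)+

text \<open>Read upward, every forbidden pattern starts with a colored part of content 0 or 1 modulo
  3; all other parts are governed by \<open>step\<close> alone.\<close>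

lemma allowed_iff:
  "allowed (Ordinary n) l \<longleftrightarrow> l = [] \<or> step (Ordinary n) (hd l)"
  "allowed (Colored (3 * k + 2)) l \<longleftrightarrow> l = [] \<or> step (Colored (3 * k + 2)) (hd l)"
  "k \<ge> 1 \<Longrightarrow> allowed (Colored (3 * k)) l \<longleftrightarrow>
     (l = [] \<or> step (Colored (3 * k)) (hd l)) \<and> \<not> prefix [Ordinary (3 * k), Ordinary (3 * k + 2)] l"
  "allowed (Colored (3 * k + 1)) l \<longleftrightarrow> (l = [] \<or> step (Colored (3 * k + 1)) (hd l))
     \<and> \<not> prefix [Colored (3 * k + 3), Ordinary (3 * k + 3)] l
     \<and> \<not> prefix [Ordinary (3 * k + 2), Ordinary (3 * k + 4), Colored (3 * k + 5)] l"
proof -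
  show "allowed (Ordinary n) l \<longleftrightarrow> l = [] \<or> step (Ordinary n) (hd l)"
    by (simp add: allowed_def)
  have "3 * m - 2 \<noteq> 3 * k + 2" "3 * m \<noteq> 3 * k + 2" for m :: nat
    by presburger+
  thus "allowed (Colored (3 * k + 2)) l \<longleftrightarrow> l = [] \<or> step (Colored (3 * k + 2)) (hd l)"
    unfolding allowed_def Cons_prefix_Cons part.inject by blast
  show "allowed (Colored (3 * k)) l \<longleftrightarrow>
     (l = [] \<or> step (Colored (3 * k)) (hd l)) \<and> \<not> prefix [Ordinary (3 * k), Ordinary (3 * k + 2)] l" if "k \<ge> 1"
  proof -
    have "3 * m - 2 \<noteq> 3 * k" "3 * m = 3 * k \<longleftrightarrow> m = k" for m :: nat
      using that by presburger+
    thus ?thesis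
      using that unfolding allowed_def Cons_prefix_Cons[of "Colored _"] part.inject by auto
  qed
  have "3 * m - 2 = 3 * k + 1 \<longleftrightarrow> m = k + 1" "3 * m \<noteq> 3 * k + 1" for m :: nat
    by presburger+
  hence *: "(\<forall>m\<ge>1. \<not> (3 * m - 2 = 3 * k + 1 \<and> P m) \<and> \<not> (3 * m = 3 * k + 1 \<and> Q m) \<and> \<not> (3 * m - 2 = 3 * k + 1 \<and> S m))
      \<longleftrightarrow> \<not> P (k + 1) \<and> \<not> S (k + 1)" for P Q S :: "nat \<Rightarrow> bool"
    by auto
  have **: "3 * (k + 1) - 1 = 3 * k + 2" "3 * (k + 1) = 3 * k + 3"
     "3 * k + 3 + 1 = 3 * k + 4" "3 * k + 3 + 2 = 3 * k + 5" "3 * k + 3 - 1 = 3 * k + 2"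
    by simp_all
  show "allowed (Colored (3 * k + 1)) l \<longleftrightarrow> (l = [] \<or> step (Colored (3 * k + 1)) (hd l))
     \<and> \<not> prefix [Colored (3 * k + 3), Ordinary (3 * k + 3)] l
     \<and> \<not> prefix [Ordinary (3 * k + 2), Ordinary (3 * k + 4), Colored (3 * k + 5)] l"
    unfolding allowed_def Cons_prefix_Cons[of "Colored _" _ "Colored (3 * k + 1)"] part.inject * ** ..
qed

section \<open>Decomposition by the smallest part\<close>

definition parts_ge :: "nat \<Rightarrow> part list set" where
  "parts_ge c = {l. ascending l \<and> (l = [] \<or> c \<le> cont (hd l))}"

definition continuations :: "part \<Rightarrow> part list set" where
  "continuations p = {l. ascending (p # l)}"

lemma parts_ge_rec:
  assumes "c \<ge> 1"
  shows "parts_ge c = parts_ge (c + 1) \<union> ((#) (Colored c) ` continuations (Colored c)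
           \<union> (#) (Ordinary c) ` continuations (Ordinary c))" (is "_ = ?rhs")
proof (rule set_eqI)
  fix l
  show "l \<in> parts_ge c \<longleftrightarrow> l \<in> ?rhs"
  proof (cases l)
    case Nil
    thus ?thesis by (simp add: parts_ge_def)
  next
    case (Cons p l')
    have "c \<le> cont p \<longleftrightarrow> c + 1 \<le> cont p \<or> p = Colored c \<or> p = Ordinary c"
      by (cases p) auto
    thus ?thesis
      by (auto simp: parts_ge_def continuations_def Cons)
  qed
qed

lemma continuations_2:
  "continuations (Ordinary (3 * k + 2)) = parts_ge (3 * k + 4)"
  "continuations (Colored (3 * k + 2)) = parts_ge (3 * k + 4)"
  unfolding continuations_def parts_ge_def ascending.simps allowed_iff(1,2) step_iff(5,6) by auto

lemma mem_continuations_iff: "l \<in> continuations p \<longleftrightarrow> 1 \<le> cont p \<and> allowed p l \<and> ascending l"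
  by (simp add: continuations_def)

lemma ascending_Cons_iff: "ascending (p # l) \<longleftrightarrow> l \<in> continuations p"
  by (simp add: continuations_def)

lemma Nil_mem_parts_ge [simp]: "[] \<in> parts_ge c"
  and Cons_mem_parts_ge_iff: "p # l \<in> parts_ge c \<longleftrightarrow> c \<le> cont p \<and> l \<in> continuations p"
  by (auto simp: parts_ge_def continuations_def)

text \<open>If \<open>Ordinary (3 * k)\<close> stands above \<open>Colored (3 * k)\<close>, the
  forbidden pattern rules out \<open>Ordinary (3 * k + 2)\<close> next, so only the first piece of
  \<open>continuations (Ordinary (3 * k))\<close> survives.\<close>

lemma continuations_0:
  assumes "k \<ge> 1"
  shows "continuations (Ordinary (3 * k)) = parts_ge (3 * k + 3) \<union> (#) (Ordinary (3 * k + 2)) ` parts_ge (3 * k + 4)"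
    and "continuations (Colored (3 * k)) = parts_ge (3 * k + 2) \<union> (#) (Ordinary (3 * k)) ` parts_ge (3 * k + 3)"
proof -
  show *: "continuations (Ordinary (3 * k)) = parts_ge (3 * k + 3) \<union> (#) (Ordinary (3 * k + 2)) ` parts_ge (3 * k + 4)"
    (is "_ = ?rhs")
  proof (rule set_eqI)
    fix l show "l \<in> continuations (Ordinary (3 * k)) \<longleftrightarrow> l \<in> ?rhs"
    proof (cases l)
      case (Cons p m)
      have "l \<in> continuations (Ordinary (3 * k)) \<longleftrightarrow>
          (p = Ordinary (3 * k + 2) \<or> 3 * k + 3 \<le> cont p) \<and> m \<in> continuations p"
        using assms by (simp add: Cons mem_continuations_iff[of "p # m"] allowed_iff(1) step_iff(1) ascending_Cons_iff
              del: ascending.simps)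
      thus ?thesis
        by (auto simp: Cons Cons_mem_parts_ge_iff continuations_2[simplified])
    qed (use assms in \<open>simp add: mem_continuations_iff allowed_iff\<close>)
  qed
  show "continuations (Colored (3 * k)) = parts_ge (3 * k + 2) \<union> (#) (Ordinary (3 * k)) ` parts_ge (3 * k + 3)"
    (is "_ = ?rhs")
  proof (rule set_eqI)
    fix l show "l \<in> continuations (Colored (3 * k)) \<longleftrightarrow> l \<in> ?rhs"
    proof (cases l)
      case (Cons p m)
      have "l \<in> continuations (Colored (3 * k)) \<longleftrightarrow> (p = Ordinary (3 * k) \<or> 3 * k + 2 \<le> cont p)
          \<and> \<not> prefix [Ordinary (3 * k), Ordinary (3 * k + 2)] (p # m) \<and> m \<in> continuations p"
        using assms
        by (simp add: Cons mem_continuations_iff[of "p # m"] allowed_iff(3) step_iff(2) ascending_Cons_iff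
              del: ascending.simps Cons_prefix_Cons)
      moreover have "m \<in> continuations (Ordinary (3 * k)) \<and> \<not> prefix [Ordinary (3 * k + 2)] m \<longleftrightarrow> m \<in> parts_ge (3 * k + 3)"
        unfolding * by (cases m) (auto simp: Cons_mem_parts_ge_iff)
      ultimately show ?thesis
        by (auto simp: Cons Cons_mem_parts_ge_iff)
    qed (use assms in \<open>simp add: mem_continuations_iff allowed_iff\<close>)
  qed
qed

text \<open>Above \<open>Colored (3 * k + 1)\<close>, the shorter forbidden pattern cuts what may
  follow \<open>Colored (3 * k + 3)\<close> down to \<open>parts_ge (3 * k + 5)\<close>; the longer
  one causes the set difference.\<close>

lemma continuations_1:
  shows "continuations (Ordinary (3 * k + 1)) = parts_ge (3 * k + 4) \<union>
      ((#) (Ordinary (3 * k + 3)) ` continuations (Ordinary (3 * k + 3)) \<union> (#) (Colored (3 * k + 2)) ` parts_ge (3 * k + 4))"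
    and "continuations (Colored (3 * k + 1)) = parts_ge (3 * k + 4) \<union>
      ((#) (Colored (3 * k + 3)) ` parts_ge (3 * k + 5) \<union>
       ((#) (Ordinary (3 * k + 3)) ` continuations (Ordinary (3 * k + 3)) \<union>
        (#) (Ordinary (3 * k + 2)) ` (parts_ge (3 * k + 4)
           - (#) (Ordinary (3 * k + 4)) ` (#) (Colored (3 * k + 5)) ` parts_ge (3 * k + 7))))"
proof -
  show "continuations (Ordinary (3 * k + 1)) = parts_ge (3 * k + 4) \<union>
      ((#) (Ordinary (3 * k + 3)) ` continuations (Ordinary (3 * k + 3)) \<union> (#) (Colored (3 * k + 2)) ` parts_ge (3 * k + 4))"
    (is "_ = ?rhs")
  proof (rule set_eqI)
    fix l show "l \<in> continuations (Ordinary (3 * k + 1)) \<longleftrightarrow> l \<in> ?rhs"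
    proof (cases l)
      case (Cons p m)
      have "l \<in> continuations (Ordinary (3 * k + 1)) \<longleftrightarrow>
          (p = Colored (3 * k + 2) \<or> p = Ordinary (3 * k + 3) \<or> 3 * k + 4 \<le> cont p) \<and> m \<in> continuations p"
        unfolding Cons mem_continuations_iff[of "p # m"] allowed_iff(1) list.sel step_iff(3) ascending_Cons_iff
        by simp
      thus ?thesis
        using continuations_2(2)[of k] by (auto simp: Cons Cons_mem_parts_ge_iff)
    qed (simp add: mem_continuations_iff allowed_iff)
  qed
  show "continuations (Colored (3 * k + 1)) = parts_ge (3 * k + 4) \<union>
      ((#) (Colored (3 * k + 3)) ` parts_ge (3 * k + 5) \<union>
       ((#) (Ordinary (3 * k + 3)) ` continuations (Ordinary (3 * k + 3)) \<union>
        (#) (Ordinary (3 * k + 2)) ` (parts_ge (3 * k + 4)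
           - (#) (Ordinary (3 * k + 4)) ` (#) (Colored (3 * k + 5)) ` parts_ge (3 * k + 7))))"
  proof (rule set_eqI)
    fix l
    define D where
      "D = parts_ge (3 * k + 4) - (#) (Ordinary (3 * k + 4)) ` (#) (Colored (3 * k + 5)) ` parts_ge (3 * k + 7)"
    have "l \<in> continuations (Colored (3 * k + 1)) \<longleftrightarrow> l \<in> parts_ge (3 * k + 4) \<union>
      ((#) (Colored (3 * k + 3)) ` parts_ge (3 * k + 5) \<union>
       ((#) (Ordinary (3 * k + 3)) ` continuations (Ordinary (3 * k + 3)) \<union> (#) (Ordinary (3 * k + 2)) ` D))"
      (is "_ \<longleftrightarrow> l \<in> ?rhs")
    proof (cases l)
      case (Cons p m)
      have l: "l \<in> continuations (Colored (3 * k + 1)) \<longleftrightarrow> (p = Ordinary (3 * k + 2) \<or> 3 * k + 3 \<le> cont p)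
          \<and> \<not> prefix [Colored (3 * k + 3), Ordinary (3 * k + 3)] (p # m)
          \<and> \<not> prefix [Ordinary (3 * k + 2), Ordinary (3 * k + 4), Colored (3 * k + 5)] (p # m)
          \<and> m \<in> continuations p"
        unfolding Cons mem_continuations_iff[of "p # m"] allowed_iff(4) list.sel step_iff(4) ascending_Cons_iff
        by simp
      have rhs: "l \<in> ?rhs \<longleftrightarrow> (3 * k + 4 \<le> cont p \<and> m \<in> continuations p)
          \<or> (p = Colored (3 * k + 3) \<and> m \<in> parts_ge (3 * k + 5))
          \<or> (p = Ordinary (3 * k + 3) \<and> m \<in> continuations p) \<or> (p = Ordinary (3 * k + 2) \<and> m \<in> D)"
        by (auto simp: Cons Cons_mem_parts_ge_iff)
      have "continuations (Colored (3 * k + 3)) = parts_ge (3 * k + 5) \<union> (#) (Ordinary (3 * k + 3)) ` parts_ge (3 * k + 6)"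
        using continuations_0(2)[of "k + 1"] by (simp add: algebra_simps)
      hence C3: "m \<in> continuations (Colored (3 * k + 3)) \<and> \<not> prefix [Ordinary (3 * k + 3)] m \<longleftrightarrow> m \<in> parts_ge (3 * k + 5)"
        by (cases m) (auto simp: Cons_mem_parts_ge_iff)
      \<comment> \<open>Any tail above \<open>Colored (3 * k + 5)\<close> lies in
        \<open>parts_ge (3 * k + 7)\<close>, so the set subtracted in \<open>D\<close> catches every
        sequence with the forbidden prefix.\<close>
      have "r \<in> parts_ge (3 * k + 7)"
        if "Ordinary (3 * k + 4) # Colored (3 * k + 5) # r \<in> parts_ge (3 * k + 4)" for r
        using that continuations_2(2)[of "k + 1"]
        by (simp add: Cons_mem_parts_ge_iff mem_continuations_iff[of "_ # _"] ascending_Cons_iff algebra_simps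
              del: ascending.simps)
      hence "m \<in> parts_ge (3 * k + 4) \<and> \<not> prefix [Ordinary (3 * k + 4), Colored (3 * k + 5)] m \<longleftrightarrow> m \<in> D"
        by (auto simp: D_def prefix_def)
      hence O2: "m \<in> continuations (Ordinary (3 * k + 2))
          \<and> \<not> prefix [Ordinary (3 * k + 4), Colored (3 * k + 5)] m \<longleftrightarrow> m \<in> D"
        unfolding continuations_2 .
      consider "p = Ordinary (3 * k + 2)" | "p = Colored (3 * k + 3)" | "p = Ordinary (3 * k + 3)"
        | "3 * k + 4 \<le> cont p" | "p \<noteq> Ordinary (3 * k + 2)" "cont p < 3 * k + 3"
        by (cases p) force+
      thus ?thesis
      proof cases
        case 1
        show ?thesis
          unfolding l rhs using O2 by (auto simp: 1)
      next
        case 2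
        show ?thesis
          unfolding l rhs using C3 by (auto simp: 2)
      qed (unfold l rhs, auto)
    qed (simp add: mem_continuations_iff allowed_iff(4)[simplified])
    thus "l \<in> continuations (Colored (3 * k + 1)) \<longleftrightarrow> l \<in> parts_ge (3 * k + 4) \<union>
      ((#) (Colored (3 * k + 3)) ` parts_ge (3 * k + 5) \<union>
       ((#) (Ordinary (3 * k + 3)) ` continuations (Ordinary (3 * k + 3)) \<union> (#) (Ordinary (3 * k + 2)) `
         (parts_ge (3 * k + 4) - (#) (Ordinary (3 * k + 4)) ` (#) (Colored (3 * k + 5)) ` parts_ge (3 * k + 7))))"
      unfolding D_def .
  qed
qed

section \<open>Generating functions of sets of sequences\<close>

definition weight :: "part list \<Rightarrow> rat fps fps" where
  "weight l = x_var ^ length l * q_var ^ psize l"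

definition gf :: "part list set \<Rightarrow> rat fps fps" where
  "gf A = infsum weight A"

text \<open>The type admits parts of content 0, which would let infinitely many lists share a size.
  Content at least 1 bounds the length by the size, so the sum over \<open>A\<close>
  converges.\<close>

definition positive :: "part list set \<Rightarrow> bool" where
  "positive A \<longleftrightarrow> (\<forall>l\<in>A. \<forall>p\<in>set l. cont p \<ge> 1)"

lemma weight_Nil [simp]: "weight [] = 1"
  by (simp add: weight_def psize_def)

lemma weight_Cons: "weight (p # l) = x_var * q_var ^ cont p * weight l"
  by (simp add: weight_def psize_def power_add mult_ac)

lemma weight_rev [simp]: "weight (rev l) = weight l"
  by (simp add: weight_def psize_def rev_map[symmetric])

lemma weight_nth_eq_0: "psize l \<noteq> n \<Longrightarrow> fps_nth (weight l) n = 0"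
  by (simp add: weight_def fps_X_power_nth)

lemma ascending_positive: "ascending l \<Longrightarrow> p \<in> set l \<Longrightarrow> cont p \<ge> 1"
  by (induction l) auto

lemma positive_parts_ge_continuations [simp]:
  "positive (parts_ge c)" "positive (continuations p)"
  by (auto simp: positive_def parts_ge_def mem_continuations_iff intro: ascending_positive simp del: One_nat_def)

lemma positive_Un [simp]: "positive (A \<union> B) \<longleftrightarrow> positive A \<and> positive B"
  by (auto simp: positive_def)

lemma positive_Diff [simp]: "positive A \<Longrightarrow> positive (A - B)"
  by (auto simp: positive_def)

lemma positive_Cons [simp]: "1 \<le> cont p \<Longrightarrow> positive A \<Longrightarrow> positive ((#) p ` A)"
  by (auto simp: positive_def)

lemma length_le_psize: "\<forall>p\<in>set l. cont p \<ge> 1 \<Longrightarrow> length l \<le> psize l"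
  by (induction l) (auto simp: psize_def)

lemma cont_le_psize: "p \<in> set l \<Longrightarrow> cont p \<le> psize l"
  by (simp add: psize_def member_le_sum_list)

lemma weight_summable:
  assumes "positive A"
  shows "weight summable_on A"
proof (rule summable_on_fps)
  fix n
  let ?P = "Ordinary ` {..n} \<union> Colored ` {..n}"
  have "{l \<in> A. fps_nth (weight l) n \<noteq> 0} \<subseteq> {l. set l \<subseteq> ?P \<and> length l \<le> n}"
  proof clarify
    fix l assume l: "l \<in> A" "fps_nth (weight l) n \<noteq> 0"
    hence n: "psize l = n"
      using weight_nth_eq_0 by blast
    have "p \<in> ?P" if "p \<in> set l" for p
      using cont_le_psize[OF that] n by (cases p) auto
    moreover have "length l \<le> n"
      using l(1) assms n length_le_psize[of l] by (auto simp: positive_def)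
    ultimately show "set l \<subseteq> ?P \<and> length l \<le> n"
      by blast
  qed
  moreover have "finite {l. set l \<subseteq> ?P \<and> length l \<le> n}"
    by (intro finite_lists_length_le) auto
  ultimately show "finite {l \<in> A. fps_nth (weight l) n \<noteq> 0}"
    by (rule finite_subset)
qed

lemma has_sum_gf: "positive A \<Longrightarrow> (weight has_sum gf A) A"
  unfolding gf_def by (simp add: weight_summable)

lemma gf_Un:
  assumes "positive A" "positive B" "A \<inter> B = {}"
  shows "gf (A \<union> B) = gf A + gf B"
  unfolding gf_def using assms by (intro infsum_Un_disjoint weight_summable)

lemma gf_Diff:
  assumes "positive A" "B \<subseteq> A"
  shows "gf (A - B) = gf A - gf B"
proof -
  have "positive B"
    using assms by (auto simp: positive_def)
  with assms have "gf ((A - B) \<union> B) = gf (A - B) + gf B"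
    by (intro gf_Un) auto
  moreover have "(A - B) \<union> B = A"
    using assms by auto
  ultimately show ?thesis
    by simp
qed

lemma gf_Cons:
  assumes "positive A"
  shows "gf ((#) p ` A) = x_var * q_var ^ cont p * gf A"
proof -
  have "((\<lambda>l. x_var * q_var ^ cont p * weight l) has_sum x_var * q_var ^ cont p * gf A) A"
    using has_sum_gf[OF assms] by (rule has_sum_cmult_right)
  also have "(\<lambda>l. x_var * q_var ^ cont p * weight l) = weight \<circ> (#) p"
    by (auto simp: weight_Cons)
  finally have "(weight has_sum x_var * q_var ^ cont p * gf A) ((#) p ` A)"
    by (subst has_sum_reindex) (auto simp: o_def)
  thus ?thesis
    unfolding gf_def by (rule infsumI)
qed

lemma parts_ge_Int_Cons [simp]: "cont p < c \<Longrightarrow> parts_ge c \<inter> (#) p ` A = {}"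
  by (auto simp: Cons_mem_parts_ge_iff)

lemma Cons_Int_Cons [simp]: "p \<noteq> r \<Longrightarrow> (#) p ` A \<inter> (#) r ` B = {}"
  by auto

lemma gf_parts_ge:
  assumes "c \<ge> 1"
  shows "gf (parts_ge c) = gf (parts_ge (c + 1)) + x_var * q_var ^ c * gf (continuations (Colored c))
           + x_var * q_var ^ c * gf (continuations (Ordinary c))"
  by (subst parts_ge_rec[OF assms]) (use assms in \<open>simp add: gf_Un gf_Cons Int_Un_distrib\<close>)

section \<open>Comparison of the two solutions\<close>

text \<open>The equations translate \<open>parts_ge_rec\<close> for contents 3j + 1, 3j + 2, 3j + 3
  after inserting the continuations; prepending a part of content 3j + m contributes t q^m.\<close>

lemma qdiff_system_gf:
  "qdiff_system q_var x_var (\<lambda>j. gf (parts_ge (3 * j + 1))) (\<lambda>j. gf (parts_ge (3 * j + 2)))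
     (\<lambda>j. gf (parts_ge (3 * j + 3)))"
  unfolding qdiff_system_def
proof
  fix j
  define t where "t = x_var * q_var ^ (3 * j)"
  define g where "g = gf (continuations (Ordinary (3 * j + 3)))"
  have t: "x_var * q_var ^ (3 * j + m) = t * q_var ^ m" for m
    by (simp add: t_def power_add mult_ac)
  have eqs: "parts_ge (3 * (j + 1) + 1) = parts_ge (3 * j + 4)" "parts_ge (3 * (j + 1) + 2) = parts_ge (3 * j + 5)"
    "parts_ge (3 * (j + 1) + 3) = parts_ge (3 * j + 6)" "parts_ge (3 * (j + 2) + 1) = parts_ge (3 * j + 7)"
    by (simp_all add: algebra_simps)
  have "continuations (Ordinary (3 * j + 3)) = parts_ge (3 * j + 6) \<union> (#) (Ordinary (3 * j + 5)) ` parts_ge (3 * j + 7)"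
       "continuations (Colored (3 * j + 3)) = parts_ge (3 * j + 5) \<union> (#) (Ordinary (3 * j + 3)) ` parts_ge (3 * j + 6)"
    using continuations_0[of "j + 1"] by (simp_all add: algebra_simps)
  hence g: "g = gf (parts_ge (3 * j + 6)) + t * q_var ^ 5 * gf (parts_ge (3 * j + 7))"
    and C3: "gf (continuations (Colored (3 * j + 3))) = gf (parts_ge (3 * j + 5)) + t * q_var ^ 3 * gf (parts_ge (3 * j + 6))"
    by (simp_all add: g_def gf_Un gf_Cons t)
  have O1: "gf (continuations (Ordinary (3 * j + 1))) =
      gf (parts_ge (3 * j + 4)) + t * q_var ^ 3 * g + t * q_var ^ 2 * gf (parts_ge (3 * j + 4))"
    unfolding continuations_1 g_def by (simp add: gf_Un gf_Cons Int_Un_distrib t t[of 2, simplified])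
  let ?E = "(#) (Ordinary (3 * j + 4)) ` (#) (Colored (3 * j + 5)) ` parts_ge (3 * j + 7)"
  \<comment> \<open>\<open>Colored (3 * j + 5)\<close> may follow
    \<open>Ordinary (3 * j + 4)\<close>, so the set difference becomes a difference of series; these
    two parts contribute t^2 q^9.\<close>
  have "?E \<subseteq> parts_ge (3 * j + 4)"
    using continuations_1(1)[of "j + 1"] by (auto simp: Cons_mem_parts_ge_iff algebra_simps)
  hence D: "gf (parts_ge (3 * j + 4) - ?E) = gf (parts_ge (3 * j + 4)) - t ^ 2 * q_var ^ 9 * gf (parts_ge (3 * j + 7))"
    by (simp add: gf_Diff gf_Cons t power2_eq_square)
  have C1: "gf (continuations (Colored (3 * j + 1))) = gf (parts_ge (3 * j + 4))
      + t * q_var ^ 3 * gf (parts_ge (3 * j + 5)) + t * q_var ^ 3 * g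
      + t * q_var ^ 2 * (gf (parts_ge (3 * j + 4)) - t ^ 2 * q_var ^ 9 * gf (parts_ge (3 * j + 7)))"
    unfolding continuations_1 g_def D[symmetric] by (simp add: gf_Un gf_Cons Int_Un_distrib t t[of 2, simplified])
  have f1: "gf (parts_ge (3 * j + 1)) = gf (parts_ge (3 * j + 2)) + t * q_var * gf (continuations (Ordinary (3 * j + 1)))
        + t * q_var * gf (continuations (Colored (3 * j + 1)))"
    using gf_parts_ge[of "3 * j + 1"] unfolding t by (simp add: add_ac)
  \<comment> \<open>Both parts of content 3j + 2 have the same continuations, whence the factor
    2.\<close>
  have f2: "gf (parts_ge (3 * j + 2)) = gf (parts_ge (3 * j + 3)) + 2 * t * q_var ^ 2 * gf (parts_ge (3 * j + 4))"
    using gf_parts_ge[of "3 * j + 2"] unfolding continuations_2 t by (simp add: eval_nat_numeral)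
  have f3: "gf (parts_ge (3 * j + 3)) = gf (parts_ge (3 * j + 4)) + t * q_var ^ 3 * gf (continuations (Colored (3 * j + 3)))
        + t * q_var ^ 3 * g"
    using gf_parts_ge[of "3 * j + 3"] unfolding t by (simp add: g_def add.commute)
  show "let t = x_var * q_var ^ (3 * j);
            g = gf (parts_ge (3 * (j + 1) + 3)) + t * q_var ^ 5 * gf (parts_ge (3 * (j + 2) + 1)) in
     gf (parts_ge (3 * j + 1)) = gf (parts_ge (3 * j + 2))
       + t * q_var * (gf (parts_ge (3 * (j + 1) + 1)) + t * q_var ^ 3 * g + t * q_var ^ 2 * gf (parts_ge (3 * (j + 1) + 1)))
       + t * q_var * (gf (parts_ge (3 * (j + 1) + 1)) + t * q_var ^ 3 * gf (parts_ge (3 * (j + 1) + 2)) + t * q_var ^ 3 * g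
           + t * q_var ^ 2 * (gf (parts_ge (3 * (j + 1) + 1)) - t ^ 2 * q_var ^ 9 * gf (parts_ge (3 * (j + 2) + 1)))) \<and>
     gf (parts_ge (3 * j + 2)) = gf (parts_ge (3 * j + 3)) + 2 * t * q_var ^ 2 * gf (parts_ge (3 * (j + 1) + 1)) \<and>
     gf (parts_ge (3 * j + 3)) = gf (parts_ge (3 * (j + 1) + 1))
       + t * q_var ^ 3 * (gf (parts_ge (3 * (j + 1) + 2)) + t * q_var ^ 3 * gf (parts_ge (3 * (j + 1) + 3))) + t * q_var ^ 3 * g"
    unfolding Let_def eqs t_def[symmetric] g[symmetric]
    by (intro conjI f2; (unfold f1 O1 C1, rule refl)?; unfold f3 C3, rule refl)
qed

lemma gf_parts_ge_minus_1_dvd: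
  assumes "N \<le> c"
  shows "q_var ^ N dvd gf (parts_ge c) - 1"
proof (rule fps_X_power_dvd_has_sum_minus_1[where z = "[]"])
  show "(weight has_sum gf (parts_ge c)) (parts_ge c)"
    by (simp add: has_sum_gf)
  fix l n assume "l \<in> parts_ge c - {[]}" "n < N"
  then obtain p m where "l = p # m" "c \<le> cont p"
    by (cases l) (auto simp: Cons_mem_parts_ge_iff)
  hence "psize l \<noteq> n"
    using cont_le_psize[of p l] \<open>n < N\<close> assms by auto
  thus "fps_nth (weight l) n = 0"
    by (rule weight_nth_eq_0)
qed auto

text \<open>Both families solve the system and agree modulo q^j at index j, hence coincide. Contents
  1 and 4 are the first component at j = 0 and j = 1, content 3 the third at j = 0.\<close>

lemma gf_parts_ge_eq_multisum:
  "gf (parts_ge 1) = multisum x_var 0 0 0 0"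
  "gf (parts_ge 3) = multisum x_var 1 2 1 1 - x_var * q_var ^ 2 * multisum x_var 3 3 2 2"
  "gf (parts_ge 4) = multisum x_var 3 3 2 2"
proof -
  define f1 where "f1 = (\<lambda>j. multisum x_var (3 * j) (3 * j) (2 * j) (2 * j))"
  define w where "w = (\<lambda>j. multisum x_var (3 * j + 1) (3 * j + 2) (2 * j + 1) (2 * j + 1))"
  define h where "h = (\<lambda>j. x_var * q_var ^ (3 * j + 2) * f1 (j + 1))"
  interpret contiguous q_var x_var "multisum x_var"
    by (rule contiguous_multisum)
  have sys: "qdiff_system q_var x_var f1 (\<lambda>j. w j + h j) (\<lambda>j. w j - h j)"
    using qdiff_system_S unfolding f1_def w_def h_def .
  have f1: "q_var ^ j dvd f1 j - 1" and w: "q_var ^ j dvd w j - 1" for j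
    unfolding f1_def w_def by (rule multisum_minus_1_dvd; simp)+
  \<comment> \<open>As a multiple of q^(3j+2), the correction \<open>h j\<close> leaves the
    congruence to 1 modulo q^j intact.\<close>
  have h: "q_var ^ j dvd h j" for j
    unfolding h_def by (intro dvd_mult2 dvd_mult le_imp_power_dvd) simp
  have gf: "q_var ^ j dvd gf (parts_ge (3 * j + m)) - 1" for j m
    by (rule gf_parts_ge_minus_1_dvd) simp
  have 1: "q_var ^ j dvd gf (parts_ge (3 * j + 1)) - f1 j" for j
    using dvd_diff[OF gf[of j 1] f1[of j]] by simp
  have 2: "q_var ^ j dvd gf (parts_ge (3 * j + 2)) - (w j + h j)" for j
    using dvd_diff[OF dvd_diff[OF gf[of j 2] w[of j]] h[of j]] by (simp add: algebra_simps)
  have 3: "q_var ^ j dvd gf (parts_ge (3 * j + 3)) - (w j - h j)" for j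
    using dvd_add[OF dvd_diff[OF gf[of j 3] w[of j]] h[of j]] by (simp add: algebra_simps)
  note unique = qdiff_system_unique[OF qdiff_system_gf sys 1 2 3]
  show "gf (parts_ge 1) = multisum x_var 0 0 0 0"
    using fun_cong[OF unique(1), of 0] by (simp add: f1_def)
  show "gf (parts_ge 3) = multisum x_var 1 2 1 1 - x_var * q_var ^ 2 * multisum x_var 3 3 2 2"
    using fun_cong[OF unique(3), of 0] by (simp add: f1_def w_def h_def numeral_2_eq_2 numeral_3_eq_3)
  show "gf (parts_ge 4) = multisum x_var 3 3 2 2"
    using fun_cong[OF unique(1), of 1] by (simp add: f1_def)
qed

section \<open>Return to \<open>R\<close> and \<open>R'\<close>\<close>

lemma ascending_hd_le: "ascending l \<Longrightarrow> p \<in> set l \<Longrightarrow> hd l \<le> p"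
proof (induction l)
  case (Cons r l)
  show ?case
  proof (cases "p = r")
    case False
    hence "p \<in> set l" "l \<noteq> []"
      using Cons.prems by auto
    hence "hd l \<le> p" "r \<le> hd l"
      using Cons by (auto simp: allowed_def step_def)
    thus ?thesis
      by simp
  qed simp
qed simp

lemma mem_image_rev_iff: "l \<in> rev ` A \<longleftrightarrow> rev l \<in> A"
  by (auto intro: rev_image_eqI)

lemma R_eq: "R = rev ` parts_ge 1"
proof -
  have "l \<in> parts_ge 1 \<longleftrightarrow> rev l \<in> R" for l
    unfolding rev_in_R_iff by (cases l) (auto simp: parts_ge_def)
  from this[of "rev _"] show ?thesis
    by (simp add: set_eq_iff mem_image_rev_iff)
qed

text \<open>The parts excluded by D4 that have positive content all lie below
  \<open>Ordinary 2\<close>, and the head is the smallest part, so D4 restricts the head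
  alone.\<close>

lemma R'_eq: "R' = rev ` (parts_ge 3 \<union> (#) (Ordinary 2) ` parts_ge 4)"
proof -
  have O2: "continuations (Ordinary 2) = parts_ge 4"
    using continuations_2(1)[of 0] by (simp add: numeral_2_eq_2)
  have "l \<in> parts_ge 3 \<union> (#) (Ordinary 2) ` parts_ge 4 \<longleftrightarrow> rev l \<in> R'" for l
  proof -
    have "rev l \<in> R' \<longleftrightarrow> ascending l \<and> D4 (rev l)"
      unfolding rev_in_R_iff[symmetric] R_def R'_def by auto
    also have "\<dots> \<longleftrightarrow> ascending l \<and> (l = [] \<or> hd l = Ordinary 2 \<or> 3 \<le> cont (hd l))"
    proof (cases "l = [] \<or> \<not> ascending l")
      case True
      thus ?thesis by (auto simp: D4_def)
    next
      case False
      have "hd l = Ordinary 2 \<or> 3 \<le> cont (hd l)" if "D4 (rev l)"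
      proof -
        have "hd l \<in> set l" "1 \<le> cont (hd l)"
          using False ascending_positive[of l "hd l"] by auto
        moreover from this that have "hd l \<noteq> Ordinary 1" "hd l \<noteq> Colored 1" "hd l \<noteq> Colored 2"
          unfolding D4_def by auto
        moreover have "p = Ordinary 2 \<or> 3 \<le> cont p"
          if "1 \<le> cont p" "p \<noteq> Ordinary 1" "p \<noteq> Colored 1" "p \<noteq> Colored 2" for p
          using that by (cases p; simp; presburger)
        ultimately show ?thesis
          by blast
      qed
      moreover have "D4 (rev l)" if "hd l = Ordinary 2 \<or> 3 \<le> cont (hd l)"
      proof -
        have "Ordinary 2 \<le> hd l"
          using that by (cases "hd l") (auto simp: less_eq_part_def less_part_def)
        hence "Ordinary 2 \<le> p" if "p \<in> set l" for p
          using ascending_hd_le[of l p] that False by auto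
        moreover have "\<not> Ordinary 2 \<le> Ordinary 1" "\<not> Ordinary 2 \<le> Colored 1" "\<not> Ordinary 2 \<le> Colored 2"
          by (simp_all add: less_eq_part_def less_part_def)
        ultimately show ?thesis
          unfolding D4_def set_rev by blast
      qed
      ultimately show ?thesis
        using False by blast
    qed
    also have "\<dots> \<longleftrightarrow> l \<in> parts_ge 3 \<union> (#) (Ordinary 2) ` parts_ge 4"
      using O2 by (cases l) (auto simp: Cons_mem_parts_ge_iff ascending_Cons_iff simp del: ascending.simps(2))
    finally show ?thesis ..
  qed
  from this[of "rev _"] show ?thesis
    by (intro set_eqI) (simp only: mem_image_rev_iff rev_rev_ident)
qed

lemma has_sum_rev_gf:
  assumes "positive A"
  shows "((\<lambda>l. x_var ^ length l * q_var ^ psize l) has_sum gf A) (rev ` A)"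
proof -
  have "(weight has_sum gf A) (rev ` A)"
    using has_sum_gf[OF assms] by (subst has_sum_reindex) (auto simp: o_def)
  thus ?thesis
    by (simp add: weight_def[abs_def])
qed

text \<open>The exponent \<open>e\<close> is kept general so that both exponents of the theorem fit:
  they are \<open>energy\<close> plus the linear forms with parameters 0, 0, 0, 0 and 1, 2, 1,
  1.\<close>

lemma has_sum_multisum:
  assumes "\<And>a b c d. e a b c d = energy (a, b, c, d) + \<alpha> * a + \<beta> * b + 3 * \<gamma> * c + 3 * \<delta> * d"
  shows "((\<lambda>(a, b, c, d). q_var ^ e a b c d * x ^ (a + b + 2 * c + 2 * d)
            / (qpoch q_var q_var a * qpoch q_var q_var b
               * qpoch (q_var ^ 3) (q_var ^ 3) c * qpoch (q_var ^ 3) (q_var ^ 3) d))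
         has_sum multisum x \<alpha> \<beta> \<gamma> \<delta>) UNIV"
proof -
  have 1: "fps_nth (qpoch q_var q_var a) 0 = 1" for a
    using qpoch_nth_0[of 1 a] by simp
  have 3: "fps_nth (qpoch (q_var ^ 3) (q_var ^ 3) a) 0 = 1" for a
    by (rule qpoch_nth_0) simp
  have "f / (qpoch q_var q_var a * qpoch q_var q_var b
               * qpoch (q_var ^ 3) (q_var ^ 3) c * qpoch (q_var ^ 3) (q_var ^ 3) d)
      = f * (qpoch_inv 1 a * qpoch_inv 1 b * qpoch_inv 3 c * qpoch_inv 3 d)" for f a b c d
    by (subst fps_divide_unit) (simp_all add: 1 3 inverse_mult_fps qpoch_inv_def)
  hence "(\<lambda>(a, b, c, d). q_var ^ e a b c d * x ^ (a + b + 2 * c + 2 * d)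
            / (qpoch q_var q_var a * qpoch q_var q_var b
               * qpoch (q_var ^ 3) (q_var ^ 3) c * qpoch (q_var ^ 3) (q_var ^ 3) d)) = summand x \<alpha> \<beta> \<gamma> \<delta>"
    by (simp add: fun_eq_iff summand_def assms)
  thus ?thesis
    unfolding multisum_def using summand_summable by simp
qed

theorem theorem1p6:
  shows "(\<exists>S.
      ((\<lambda>l. x_var ^ length l * q_var ^ psize l) has_sum S) R \<and>
      ((\<lambda>(a, b, c, d).
          q_var ^ (a^2 + b^2 + 3*c^2 + 3*d^2 + 2*a*b + 3*a*c + 3*a*d + 3*b*c + 3*b*d + 6*c*d)
            * x_var ^ (a + b + 2*c + 2*d)
          / (qpoch q_var q_var a * qpoch q_var q_var b
             * qpoch (q_var^3) (q_var^3) c * qpoch (q_var^3) (q_var^3) d))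
        has_sum S) UNIV)
    \<and> (\<exists>S'.
      ((\<lambda>l. x_var ^ length l * q_var ^ psize l) has_sum S') R' \<and>
      ((\<lambda>(a, b, c, d).
          q_var ^ (a*(a+1) + b*(b+2) + 3*c*(c+1) + 3*d*(d+1)
                   + 2*a*b + 3*a*c + 3*a*d + 3*b*c + 3*b*d + 6*c*d)
            * x_var ^ (a + b + 2*c + 2*d)
          / (qpoch q_var q_var a * qpoch q_var q_var b
             * qpoch (q_var^3) (q_var^3) c * qpoch (q_var^3) (q_var^3) d))
        has_sum S') UNIV)"
proof (intro conjI exI)
  show "((\<lambda>l. x_var ^ length l * q_var ^ psize l) has_sum multisum x_var 0 0 0 0) R"
    unfolding R_eq gf_parts_ge_eq_multisum(1)[symmetric] by (rule has_sum_rev_gf) simp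
  \<comment> \<open>The term - x q^2 S(3,3,2,2) in the series of \<open>parts_ge 3\<close> cancels
    against the contribution of the sequences with smallest part \<open>Ordinary 2\<close>.\<close>
  have "gf (parts_ge 3 \<union> (#) (Ordinary 2) ` parts_ge 4) = multisum x_var 1 2 1 1"
    using gf_parts_ge_eq_multisum(2,3) by (simp add: gf_Un gf_Cons)
  thus "((\<lambda>l. x_var ^ length l * q_var ^ psize l) has_sum multisum x_var 1 2 1 1) R'"
    unfolding R'_eq by (metis has_sum_rev_gf positive_Un positive_Cons positive_parts_ge_continuations(1) cont.simps(1) one_le_numeral)
qed (rule has_sum_multisum; simp add: energy_def algebra_simps power2_eq_square)+

end
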